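(* There exist a homeomorphism $f:\mathbb{T}^2\to\mathbb{T}^2$ homotopic to the identity and a lift $F:\mathbb{R}^2\to\mathbb{R}^2$ of $f$ such that all of the following hold: (a) there is a non-empty open set $V\subseteq\mathbb{R}^2\setminus\{0\}$ such that for every $v\in V$ there is a minimal set $M_v\subseteq\mathbb{T}^2$ of $f$ for which $\rho_{M_v}(F)$ is a line segment of positive length contained in the line $v+\mathbb{R}v^\perp$; (b) there is a minimal set $M\subseteq\mathbb{T}^2$ of $f$ such that the rotation set $\rho_M(F)$ is plane-separating; (c) there is a minimal set $M'\subseteq\mathbb{T}^2$ of $f$ such that the rotation set $\rho_{M'}(F)$ has non-empty interior.
   Context: $\mathbb{T}^2=\mathbb{R}^2/\mathbb{Z}^2$ and $\pi:\mathbb{R}^2\to\mathbb{T}^2$ is the canonical projection. A lift of $f$ is a continuous map $F:\mathbb{R}^2\to\mathbb{R}^2$ with $\pi\circ F=f\circ\pi$. For $M\subseteq\mathbb{T}^2$, the rotation set of $F$ on $M$ is $$\rho_M(F)=\Big\{\rho\in\mathbb{R}^2 : \exists\, n_i\nearrow\infty,\ z_i\in\pi^{-1}(M)\text{ with } \lim_{i\to\infty}\big(F^{n_i}(z_i)-z_i\big)/n_i=\rho\Big\}.$$ A minimal set of $f$ is a non-empty compact $f$-invariant set containing no proper non-empty compact $f$-invariant subset. For $v\in\mathbb{R}^2\setminus\{0\}$, $v^\perp$ denotes a non-zero vector orthogonal to $v$. A set $A\subseteq\mathbb{R}^2$ is plane-separating if $\mathbb{R}^2\setminus A$ is not connected.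 The interior is taken in $\mathbb{R}^2$. *)

theory Defs
  imports "HOL-Analysis.Analysis"
begin

definition lattice_eq :: "real^2 \<Rightarrow> real^2 \<Rightarrow> bool" where
  "lattice_eq x y \<longleftrightarrow> (\<forall>i. x $ i - y $ i \<in> \<int>)"

lemma equivp_lattice_eq: "equivp lattice_eq"
proof (rule equivpI)
  show "reflp lattice_eq"
    by (simp add: reflp_def lattice_eq_def)
  show "symp lattice_eq"
    unfolding symp_def lattice_eq_def by (metis Ints_minus minus_diff_eq)
  show "transp lattice_eq"
    unfolding transp_def lattice_eq_def
    by (metis Ints_add add_diff_eq diff_add_cancel)
qed

quotient_type torus = "real^2" / lattice_eq
  morphisms torus_rep torus_proj
  by (rule equivp_lattice_eq)

(* The quotient topology. *)
instantiation torus :: topological_space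
begin

definition open_torus :: "torus set \<Rightarrow> bool" where
  "open_torus U \<longleftrightarrow> open (torus_proj -` U)"

instance
proof
  show "open (UNIV :: torus set)"
    by (simp add: open_torus_def)
  show "open (S \<inter> T)" if "open S" "open T" for S T :: "torus set"
    using that by (simp add: open_torus_def vimage_Int open_Int)
  show "open (\<Union>K)" if "\<forall>S\<in>K. open S" for K :: "torus set set"
    using that by (auto simp: open_torus_def vimage_Union)
qed

end

lemma torus_proj_eq_iff: "torus_proj x = torus_proj y \<longleftrightarrow> (\<forall>i. x $ i - y $ i \<in> \<int>)"
  by (simp add: torus.abs_eq_iff lattice_eq_def)

lemma surj_torus_proj: "surj torus_proj"
  by (metis Quotient3_abs_rep Quotient3_torus surjI)

lemma quotient_map_torus_proj: "quotient_map euclidean euclidean torus_proj"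
  by (simp add: quotient_map_def surj_torus_proj open_torus_def vimage_def)

definition is_lift :: "(torus \<Rightarrow> torus) \<Rightarrow> (real^2 \<Rightarrow> real^2) \<Rightarrow> bool" where
  "is_lift f F \<longleftrightarrow> continuous_on UNIV F \<and> torus_proj \<circ> F = f \<circ> torus_proj"

definition rotation_set :: "torus set \<Rightarrow> (real^2 \<Rightarrow> real^2) \<Rightarrow> (real^2) set" where
  "rotation_set M F =
    {\<rho>. \<exists>(n :: nat \<Rightarrow> nat) (z :: nat \<Rightarrow> real^2).
       strict_mono n \<and> (\<forall>i. z i \<in> torus_proj -` M) \<and>
       (\<lambda>i. ((F ^^ n i) (z i) - z i) /\<^sub>R real (n i)) \<longlonglongrightarrow> \<rho>}"

(* Full invariance, as usual for homeomorphisms; requiring only f ` M \<subseteq> M would give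
   the same minimal sets of a homeomorphism. *)
definition invariant_set :: "('a \<Rightarrow> 'a) \<Rightarrow> 'a set \<Rightarrow> bool" where
  "invariant_set f M \<longleftrightarrow> f ` M = M"

definition minimal_set :: "('a::topological_space \<Rightarrow> 'a) \<Rightarrow> 'a set \<Rightarrow> bool" where
  "minimal_set f M \<longleftrightarrow>
     M \<noteq> {} \<and> compact M \<and> invariant_set f M \<and>
     \<not> (\<exists>K. K \<subset> M \<and> K \<noteq> {} \<and> compact K \<and> invariant_set f K)"

definition plane_separating :: "(real^2) set \<Rightarrow> bool" where
  "plane_separating A \<longleftrightarrow> \<not> connected (UNIV - A)"

end

theory Submission imports Defs begin

text \<open>
  The homeomorphism is induced by \<open>F(x, y) = (x', y + L \<tau>(x'))\<close> with \<open>x' = x + L \<tau>(y)\<close>, where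
  \<open>\<tau>\<close> is the \<open>1\<close>-periodic triangle wave with \<open>\<tau>(y) = y\<close> on \<open>[0, 1/2]\<close>. The slope \<open>L = \<lambda> - 1/\<lambda>\<close>
  with \<open>\<lambda> = 11\<close> is so large that the map has a horseshoe: along orbits that stay, modulo the
  lattice, in \<open>[0, 1/2] \<times> [0, 1/2]\<close>, the coordinates listed in the order \<open>x, y, x', y', \<dots>\<close> are
  \<open>v\<close> plus integers, where \<open>L v\<^sub>j = r\<^sub>j + v\<^sub>j\<^sub>+\<^sub>1 - v\<^sub>j\<^sub>-\<^sub>1\<close> and \<open>r\<close> lists the integral steps.
  This linear recurrence is hyperbolic: for every \<open>r\<close> with values in \<open>[1, 4]\<close> it has a bounded
  solution, that solution lies in \<open>[0, 1/2]\<close>, and changing \<open>r\<close> far away from \<open>j\<close> changes \<open>v\<^sub>j\<close>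
  by an exponentially small amount. Hence every sequence \<open>s\<close> of integral displacement vectors
  with entries in \<open>{1, \<dots>, 4}\<close> is followed by an orbit, and if \<open>s\<close> is uniformly recurrent, so
  is that orbit in the torus; its closure is then minimal. As the displacement over \<open>n\<close> steps
  is a sum of \<open>s\<close> over a window of length \<open>n\<close> up to a bounded error, the rotation set of the
  closure is the set of limits of averages of \<open>s\<close> over windows whose lengths tend to infinity
  (lemma \<open>coded_minimal_set\<close>).

  What remains is combinatorial: to construct uniformly recurrent sequences with prescribed
  averages. The integers are divided into centred blocks of level \<open>K\<close>, each block of level \<open>K
  + 1\<close> consisting of \<open>3 ^ (K + 1)\<close> blocks of level \<open>K\<close>. The central one of these is always a
  copy of one fixed block \<open>W\<^sub>K\<close>, whose average is close to a prescribed vector \<open>x\<^sub>K\<close>; the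
  others share what remains of the total of the large block as evenly as possible. The central
  copies make the sequence uniformly recurrent, but they are so rare that they hardly
  influence the average of a long window. A window whose length lies between the scales \<open>K\<close>
  and \<open>K + 1\<close> therefore sees at most two different averages, each of them close to some \<open>x\<^sub>i\<close>:
  either one block of level \<open>K + 2\<close> and perhaps its centre, or two adjacent blocks of level \<open>K
  + 2\<close> away from their centres. So all limits of window averages are approximated by convex
  combinations \<open>(1 - \<theta>) x\<^sub>i + \<theta> x\<^sub>j\<close>. Conversely, windows near the right end of \<open>W\<^sub>K\<close> inside
  \<open>W\<^sub>K\<^sub>+\<^sub>1\<close> have averages near any given combination of \<open>x\<^sub>K\<close> and \<open>x\<^sub>K\<^sub>+\<^sub>1\<close> (lemma
  \<open>recurrent_sequence_with_prescribed_windows\<close>).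

  Three choices of \<open>x\<close> give the theorem. If \<open>x\<close> alternates between \<open>v - w/16\<close> and \<open>v + w/16\<close>
  with \<open>w\<close> orthogonal to \<open>v\<close>, the rotation set is the segment between these points. If \<open>x\<close>
  runs cyclically through the vertices of a triangle, it is the boundary of the triangle,
  since only two vertices are mixed at a time. If \<open>x\<close> is dense in a disc, it contains the
  disc.
\<close>

section \<open>The torus as a compact regular space\<close>

lemma torus_proj_rep [simp]: "torus_proj (torus_rep t) = t"
  by (rule Quotient3_abs_rep[OF Quotient3_torus])

lemma continuous_on_torus_proj: "continuous_on S torus_proj"
proof -
  have "continuous_on UNIV torus_proj"
    by (simp add: continuous_on_open_vimage open_torus_def)
  then show ?thesis by (rule continuous_on_subset) simp
qed

definition integral_vector :: "real^2 \<Rightarrow> bool" where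
  "integral_vector k \<longleftrightarrow> (\<forall>i. k $ i \<in> \<int>)"

lemma torus_proj_eq_translate:
  "torus_proj w = torus_proj z \<longleftrightarrow> (\<exists>k. integral_vector k \<and> w = z + k)"
proof
  assume "torus_proj w = torus_proj z"
  then show "\<exists>k. integral_vector k \<and> w = z + k"
    by (intro exI[of _ "w - z"]) (simp add: torus_proj_eq_iff integral_vector_def)
qed (auto simp: torus_proj_eq_iff integral_vector_def)

lemma torus_proj_translate [simp]: "integral_vector k \<Longrightarrow> torus_proj (z + k) = torus_proj z"
  using torus_proj_eq_translate by blast

lemma open_image_torus_proj:
  assumes "open U"
  shows "open (torus_proj ` U)"
proof -
  have "torus_proj -` torus_proj ` U = (\<Union>k\<in>{k. integral_vector k}. (\<lambda>z. k + z) ` U)"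
  proof (intro equalityI subsetI)
    fix w assume "w \<in> torus_proj -` torus_proj ` U"
    then obtain z where "z \<in> U" "torus_proj w = torus_proj z" by auto
    then show "w \<in> (\<Union>k\<in>{k. integral_vector k}. (\<lambda>z. k + z) ` U)"
      by (auto simp: torus_proj_eq_translate image_iff add.commute)
  next
    fix w assume "w \<in> (\<Union>k\<in>{k. integral_vector k}. (\<lambda>z. k + z) ` U)"
    then obtain k z where "integral_vector k" "z \<in> U" "w = z + k" by (auto simp: add.commute)
    then show "w \<in> torus_proj -` torus_proj ` U" by simp
  qed
  then show ?thesis
    using assms by (auto simp: open_torus_def intro: open_translation)
qed

lemma continuous_on_from_torus:
  fixes g :: "torus \<Rightarrow> 'b::topological_space"
  assumes "continuous_on UNIV (g \<circ> torus_proj)"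
  shows "continuous_on UNIV g"
  using assms by (simp add: continuous_on_open_vimage open_torus_def vimage_comp o_def)

lemma compact_torus: "compact (UNIV :: torus set)"
proof -
  have "t \<in> torus_proj ` cbox 0 1" for t
  proof -
    define z where "z = torus_rep t"
    define w :: "real^2" where "w = (\<chi> i. frac (z $ i))"
    have "torus_proj w = torus_proj z"
      by (simp add: torus_proj_eq_iff w_def frac_def)
    moreover have "w \<in> cbox 0 1"
      by (simp add: w_def mem_box_cart frac_ge_0 frac_lt_1 less_imp_le)
    ultimately show ?thesis by (metis image_eqI torus_proj_rep z_def)
  qed
  then have "(UNIV :: torus set) = torus_proj ` cbox 0 1" by auto
  then show ?thesis
    using compact_continuous_image[OF continuous_on_torus_proj compact_cbox] by metis
qed

text \<open>
  This embedding of the torus into a metric space supplies the separation properties of the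
  quotient topology.
\<close>
definition circle_pair :: "torus \<Rightarrow> complex \<times> complex" where
  "circle_pair t = (cis (2 * pi * torus_rep t $ 1), cis (2 * pi * torus_rep t $ 2))"

lemma cis_two_pi_eq_iff: "cis (2 * pi * x) = cis (2 * pi * y) \<longleftrightarrow> x - y \<in> \<int>"
proof -
  have "cis (2 * pi * x) = cis (2 * pi * y) \<longleftrightarrow> (\<exists>n::int. 2 * pi * x = 2 * pi * y + 2 * pi * n)"
    by (subst sin_cos_eq_iff[symmetric]) (auto simp: complex_eq_iff)
  also have "\<dots> \<longleftrightarrow> (\<exists>n::int. x - y = n)"
  proof (intro ex_cong1)
    fix n :: int
    have "2 * pi * x = 2 * pi * y + 2 * pi * n \<longleftrightarrow> 2 * pi * (x - y) = 2 * pi * n"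
      by (simp add: algebra_simps)
    then show "2 * pi * x = 2 * pi * y + 2 * pi * n \<longleftrightarrow> x - y = n" by simp
  qed
  also have "\<dots> \<longleftrightarrow> x - y \<in> \<int>" by (auto simp: Ints_def)
  finally show ?thesis .
qed

lemma circle_pair_proj: "circle_pair (torus_proj z) = (cis (2 * pi * z $ 1), cis (2 * pi * z $ 2))"
  using torus_proj_eq_iff[of "torus_rep (torus_proj z)" z]
  by (simp add: circle_pair_def cis_two_pi_eq_iff)

lemma inj_circle_pair: "inj circle_pair"
proof
  fix s t assume "circle_pair s = circle_pair t"
  then have "torus_proj (torus_rep s) = torus_proj (torus_rep t)"
    unfolding torus_proj_eq_iff by (simp add: circle_pair_def cis_two_pi_eq_iff forall_2)
  then show "s = t" by simp
qed

lemma continuous_on_circle_pair: "continuous_on UNIV circle_pair"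
proof (rule continuous_on_from_torus)
  show "continuous_on UNIV (circle_pair \<circ> torus_proj)"
    unfolding o_def circle_pair_proj by (intro continuous_intros)
qed

instance torus :: t3_space
proof
  have open_vimage: "open (circle_pair -` U)" if "open U" for U
    using continuous_on_circle_pair that by (simp add: continuous_on_open_vimage)
  show "\<exists>U V. open U \<and> open V \<and> x \<in> U \<and> y \<in> V \<and> U \<inter> V = {}" if "x \<noteq> y" for x y :: torus
  proof -
    have "circle_pair x \<noteq> circle_pair y" using that inj_circle_pair by (simp add: inj_eq)
    from hausdorff[OF this] obtain U V
      where "open U" "open V" "circle_pair x \<in> U" "circle_pair y \<in> V" "U \<inter> V = {}" by auto
    then show ?thesis
      by (intro exI[of _ "circle_pair -` U"] exI[of _ "circle_pair -` V"]) (auto simp: open_vimage)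
  qed
  show "\<exists>U V. open U \<and> open V \<and> y \<in> U \<and> S \<subseteq> V \<and> U \<inter> V = {}" if "closed S" "y \<notin> S" for S and y :: torus
  proof -
    have "compact S" using compact_Int_closed[OF compact_torus that(1)] by simp
    then have "closed (circle_pair ` S)"
      by (intro compact_imp_closed compact_continuous_image
          continuous_on_subset[OF continuous_on_circle_pair]) auto
    moreover have "circle_pair y \<notin> circle_pair ` S"
      using that(2) inj_circle_pair by (auto simp: inj_eq)
    ultimately have "\<exists>U V. open U \<and> open V \<and> circle_pair y \<in> U \<and> circle_pair ` S \<subseteq> V \<and> U \<inter> V = {}"
      by (rule t3_space)
    then obtain U V where "open U" "open V" "circle_pair y \<in> U" "circle_pair ` S \<subseteq> V" "U \<inter> V = {}"
      by auto
    then show ?thesis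
      by (intro exI[of _ "circle_pair -` U"] exI[of _ "circle_pair -` V"]) (auto simp: open_vimage)
  qed
qed

section \<open>Minimal sets from recurrent orbits\<close>

lemma continuous_on_iterate:
  fixes F :: "'a::topological_space \<Rightarrow> 'a"
  assumes "continuous_on UNIV F"
  shows "continuous_on UNIV (F ^^ n)"
proof (induction n)
  case (Suc n)
  have "continuous_on UNIV (F \<circ> (F ^^ n))"
    using Suc assms by (intro continuous_on_compose) (auto intro: continuous_on_subset)
  then show ?case by simp
qed (simp add: continuous_on_id)

text \<open>
  The window of radius \<open>N\<close> around \<open>0\<close> reappears along an entire arithmetic progression of
  places. This is stronger than recurrence with bounded gaps, and it is what block
  constructions yield.
\<close>
definition uniformly_recurrent :: "(int \<Rightarrow> 'a) \<Rightarrow> bool" where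
  "uniformly_recurrent s \<longleftrightarrow> (\<forall>N. \<exists>P>0. \<forall>i t. \<bar>t\<bar> \<le> N \<longrightarrow> s (t + i * P) = s t)"

text \<open>
  Let \<open>K\<close> be a closed invariant subset that misses \<open>h 0\<close>, and separate the two by
  neighbourhoods. A point of \<open>K\<close> stays in the neighbourhood of \<open>K\<close> forever, so some point of
  the orbit close to it stays there for \<open>P\<close> steps. But any \<open>P\<close> consecutive points of the orbit
  include one near \<open>h 0\<close>.
\<close>
lemma orbit_closure_minimal:
  fixes f :: "'a::t3_space \<Rightarrow> 'a" and h :: "int \<Rightarrow> 'a"
  assumes compact: "compact (UNIV :: 'a set)" and homeo: "homeomorphism UNIV UNIV f g"
    and orbit: "\<And>n. f (h n) = h (n + 1)"
    and recurrent: "\<And>U. open U \<Longrightarrow> h 0 \<in> U \<Longrightarrow> \<exists>P>0. \<forall>i. h (i * P) \<in> U"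
  shows "minimal_set f (closure (range h))"
proof -
  define M where "M = closure (range h)"
  have fg: "f (g z) = z" "g (f z) = z" for z
    using homeo by (auto simp: homeomorphism_def)
  have cont: "continuous_on UNIV f" "continuous_on UNIV g"
    using homeo by (auto simp: homeomorphism_def)
  have backwards: "g (h n) = h (n - 1)" for n
    using orbit[of "n - 1"] fg(2) by (metis diff_add_cancel)
  have range_M: "range h \<subseteq> M" unfolding M_def by (rule closure_subset)
  have sub: "f ` M \<subseteq> M" "g ` M \<subseteq> M"
  proof -
    have "f ` range h \<subseteq> M" "g ` range h \<subseteq> M"
      using range_M orbit backwards by auto
    moreover have "continuous_on M f" "continuous_on M g" "closed M"
      using cont continuous_on_subset by (auto simp: M_def)
    ultimately show "f ` M \<subseteq> M" "g ` M \<subseteq> M"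
      unfolding M_def by (meson image_closure_subset)+
  qed
  have inv: "invariant_set f M"
  proof -
    have "z \<in> f ` M" if "z \<in> M" for z using sub(2) that fg(1) by (metis image_subset_iff imageI)
    then show ?thesis using sub(1) by (auto simp: invariant_set_def)
  qed
  have "M \<subseteq> K" if K: "K \<subseteq> M" "K \<noteq> {}" "compact K" "invariant_set f K" for K
  proof -
    have closed: "closed K" using K(3) by (rule compact_imp_closed)
    have fK: "f z \<in> K \<longleftrightarrow> z \<in> K" for z
      using K(4) fg(2) unfolding invariant_set_def by (metis imageE imageI)
    have iter: "(f ^^ n) z \<in> K \<longleftrightarrow> z \<in> K" for n z by (induction n) (simp_all add: fK)
    have orbit_iter: "(f ^^ n) (h k) = h (k + int n)" for n k
      by (induction n) (simp_all add: orbit algebra_simps)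
    have "h 0 \<in> K"
    proof (rule ccontr)
      assume "h 0 \<notin> K"
      then obtain U V where UV: "open U" "open V" "h 0 \<in> U" "K \<subseteq> V" "U \<inter> V = {}"
        using t3_space[OF closed] by metis
      obtain P where P: "P > 0" "\<And>i. h (i * P) \<in> U" using recurrent[OF UV(1,3)] by blast
      obtain z where z: "z \<in> K" using K(2) by blast
      define W where "W = (\<Inter>n\<in>{..nat P}. (f ^^ n) -` V)"
      have "open W"
        unfolding W_def using UV(2) continuous_on_iterate[OF cont(1)]
        by (intro open_INT) (auto simp: continuous_on_open_vimage)
      moreover have "z \<in> W" using z iter UV(4) by (auto simp: W_def)
      moreover have "z \<in> closure (range h)" using z K(1) by (auto simp: M_def)
      ultimately obtain k where k: "h k \<in> W"
        using closure_iff_nhds_not_empty[of z "range h"] by (metis (no_types, lifting) disjoint_iff rangeE subset_refl)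
      (* the number of steps from k to the next multiple of P *)
      define n where "n = nat (- k mod P)"
      have "- k mod P < P" "- k mod P \<ge> 0" using P(1) by auto
      then have "n \<in> {..nat P}" by (simp add: n_def nat_mono)
      then have "h (k + int n) \<in> V" using k by (auto simp: W_def orbit_iter)
      moreover have "k + int n = (- ((- k) div P)) * P"
      proof -
        have "int n = - k mod P" using P(1) by (simp add: n_def)
        then show ?thesis using div_mult_mod_eq[of "- k" P] by linarith
      qed
      ultimately show False using P(2)[of "- ((- k) div P)"] UV(5) by auto
    qed
    have "h (int n) \<in> K" for n
      using orbit_iter[of n 0] iter[of n "h 0"] \<open>h 0 \<in> K\<close> by simp
    moreover have "h (- int n) \<in> K" for n
      using orbit_iter[of n "- int n"] iter[of n "h (- int n)"] \<open>h 0 \<in> K\<close> by simp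
    ultimately have "range h \<subseteq> K" by (metis image_subset_iff int_cases2)
    then show ?thesis unfolding M_def using closed by (rule closure_minimal)
  qed
  moreover have "compact M" unfolding M_def using compact_Int_closed[OF compact closed_closure] by simp
  moreover have "M \<noteq> {}" by (simp add: M_def)
  ultimately show ?thesis using inv unfolding M_def[symmetric] minimal_set_def by blast
qed

section \<open>Lifts that commute with the lattice\<close>

definition induced_map :: "(real^2 \<Rightarrow> real^2) \<Rightarrow> torus \<Rightarrow> torus" where
  "induced_map F = torus_proj \<circ> F \<circ> torus_rep"

definition lattice_equivariant :: "(real^2 \<Rightarrow> real^2) \<Rightarrow> bool" where
  "lattice_equivariant F \<longleftrightarrow> (\<forall>z k. integral_vector k \<longrightarrow> F (z + k) = F z + k)"

lemma induced_map_proj: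
  assumes "lattice_equivariant F"
  shows "induced_map F (torus_proj z) = torus_proj (F z)"
proof -
  obtain k where "integral_vector k" "torus_rep (torus_proj z) = z + k"
    using torus_proj_eq_translate[of "torus_rep (torus_proj z)" z] by auto
  then show ?thesis using assms by (simp add: induced_map_def lattice_equivariant_def)
qed

lemma is_lift_induced_map:
  assumes "lattice_equivariant F" "continuous_on UNIV F"
  shows "is_lift (induced_map F) F"
  using assms(2) by (simp add: is_lift_def fun_eq_iff induced_map_proj[OF assms(1)])

lemma continuous_induced_map:
  assumes "lattice_equivariant F" "continuous_on UNIV F"
  shows "continuous_on UNIV (induced_map F)"
proof (rule continuous_on_from_torus)
  have "induced_map F \<circ> torus_proj = torus_proj \<circ> F"
    by (simp add: fun_eq_iff induced_map_proj[OF assms(1)])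
  then show "continuous_on UNIV (induced_map F \<circ> torus_proj)"
    using continuous_on_compose[OF assms(2) continuous_on_torus_proj] by simp
qed

lemma homeomorphism_induced_map:
  assumes "lattice_equivariant F" "continuous_on UNIV F" "lattice_equivariant G" "continuous_on UNIV G"
    and inverse: "\<And>z. G (F z) = z" "\<And>z. F (G z) = z"
  shows "homeomorphism UNIV UNIV (induced_map F) (induced_map G)"
proof
  fix t :: torus
  obtain z where t: "t = torus_proj z" by (metis torus_proj_rep)
  show "induced_map G (induced_map F t) = t" "induced_map F (induced_map G t) = t"
    by (simp_all add: t induced_map_proj assms(1,3) inverse)
qed (simp_all add: continuous_induced_map assms(1-4))

text \<open>
  The straight-line homotopy from \<open>F\<close> to the identity commutes with the lattice, so it
  descends to the torus. The descended map is continuous because the projection is open.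
\<close>
lemma homotopic_induced_map_id:
  assumes F: "lattice_equivariant F" "continuous_on UNIV F"
  shows "homotopic_with_canon (\<lambda>_. True) UNIV UNIV (induced_map F) id"
proof -
  define H where "H = (\<lambda>(t, z). (1 - t) *\<^sub>R F z + t *\<^sub>R z)"
  define h where "h = (\<lambda>(t, w). torus_proj (H (t, torus_rep w)))"
  have cont_H: "continuous_on UNIV (\<lambda>p. torus_proj (H p))"
  proof -
    have "continuous_on UNIV H"
      unfolding H_def case_prod_beta
      by (intro continuous_intros continuous_on_compose2[OF F(2)]) auto
    then show ?thesis
      using continuous_on_compose2[OF continuous_on_torus_proj] by blast
  qed
  have h_proj: "h (t, torus_proj z) = torus_proj (H (t, z))" for t z
  proof -
    obtain k where k: "integral_vector k" "torus_rep (torus_proj z) = z + k"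
      using torus_proj_eq_translate[of "torus_rep (torus_proj z)" z] by auto
    have "H (t, z + k) = H (t, z) + k"
    proof -
      have "F (z + k) = F z + k" using F(1) k(1) by (simp add: lattice_equivariant_def)
      then show ?thesis by (simp add: H_def algebra_simps)
    qed
    then show ?thesis using k by (simp add: h_def)
  qed
  have "continuous_on UNIV h"
  proof -
    have "open (h -` U)" if "open U" for U
    proof (subst open_subopen, intro ballI)
      fix p assume "p \<in> h -` U"
      moreover obtain t z where p: "p = (t, torus_proj z)" by (metis torus_proj_rep surj_pair)
      ultimately have "(t, z) \<in> (\<lambda>p. torus_proj (H p)) -` U" by (simp add: h_proj)
      moreover have "open ((\<lambda>p. torus_proj (H p)) -` U)"
        using cont_H that by (simp add: continuous_on_open_vimage)
      ultimately obtain A B where AB: "open A" "open B" "(t, z) \<in> A \<times> B"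
        "A \<times> B \<subseteq> (\<lambda>p. torus_proj (H p)) -` U"
        by (metis open_prod_elim)
      have "A \<times> torus_proj ` B \<subseteq> h -` U" using AB(4) by (auto simp: h_proj)
      moreover have "open (A \<times> torus_proj ` B)" using AB by (intro open_Times open_image_torus_proj)
      moreover have "p \<in> A \<times> torus_proj ` B" using AB(3) p by auto
      ultimately show "\<exists>T. open T \<and> p \<in> T \<and> T \<subseteq> h -` U" by blast
    qed
    then show ?thesis by (simp add: continuous_on_open_vimage)
  qed
  then have "continuous_on ({0..1} \<times> UNIV) h" by (rule continuous_on_subset) simp
  then have "continuous_map (prod_topology (top_of_set {0..1}) (top_of_set UNIV)) (top_of_set UNIV) h"
    by (simp add: prod_topology_subtopology(1))
  moreover have "\<forall>w. h (0, w) = induced_map F w" "\<forall>w. h (1, w) = id w"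
    by (simp_all add: h_def H_def induced_map_def)
  ultimately show ?thesis unfolding homotopic_with_def by blast
qed

section \<open>Rotation sets as limits of window averages\<close>

text \<open>
  For a sequence of displacements this is the symbolic counterpart of a rotation set; as
  there, the position of the window may vary with its length.
\<close>
definition window_limits :: "(int \<Rightarrow> 'a::real_normed_vector) \<Rightarrow> 'a set" where
  "window_limits s = {\<rho>. \<forall>e>0. \<forall>N. \<exists>n\<ge>N. \<exists>u. n > 0 \<and>
     norm (sum s {u..<u + int n} /\<^sub>R real n - \<rho>) < e}"

lemma window_limitsI:
  assumes "\<And>e N. e > 0 \<Longrightarrow> \<exists>n\<ge>N. \<exists>u. n > 0 \<and> norm (sum s {u..<u + int n} /\<^sub>R real n - \<rho>) < e"
  shows "\<rho> \<in> window_limits s"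
  using assms by (auto simp: window_limits_def)

lemma window_limitsE:
  assumes "\<rho> \<in> window_limits s" "e > 0"
  obtains n u where "n \<ge> N" "n > 0" "norm (sum s {u..<u + int n} /\<^sub>R real n - \<rho>) < e"
  using assms unfolding window_limits_def by blast

lemma lattice_equivariant_iterate:
  assumes "lattice_equivariant F" "integral_vector k"
  shows "(F ^^ n) (z + k) = (F ^^ n) z + k"
  using assms by (induction n) (auto simp: lattice_equivariant_def)

lemma integral_vector_sum:
  assumes "\<And>t. t \<in> A \<Longrightarrow> integral_vector (s t)"
  shows "integral_vector (sum s A)"
  using assms by (auto simp: integral_vector_def intro!: Ints_sum)

lemma iterate_along_orbit:
  assumes "lattice_equivariant F" "\<And>n. integral_vector (s n)" "\<And>n. F (c n) = c (n + 1) + s n"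
  shows "(F ^^ n) (c k) = c (k + int n) + sum s {k..<k + int n}"
proof (induction n)
  case (Suc n)
  have "{k..<k + int (Suc n)} = insert (k + int n) {k..<k + int n}" by auto
  moreover have "F (c (k + int n) + sum s {k..<k + int n}) = F (c (k + int n)) + sum s {k..<k + int n}"
    using assms(1,2) integral_vector_sum[of _ s] by (simp add: lattice_equivariant_def)
  ultimately show ?case using Suc assms(3)[of "k + int n"] by (simp add: algebra_simps)
qed simp

lemma norm_scaled_le:
  fixes a b :: "'a::real_normed_vector"
  assumes "norm (a - b) \<le> d" "n > 0"
  shows "norm (a /\<^sub>R real n - b /\<^sub>R real n) \<le> d / real n"
proof -
  have "norm (a /\<^sub>R real n - b /\<^sub>R real n) = norm (a - b) / real n"
    by (simp add: scaleR_diff_right[symmetric] divide_inverse mult.commute)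
  then show ?thesis using assms by (simp add: divide_right_mono)
qed

text \<open>
  Displacements over a fixed number of steps are continuous and invariant under the lattice,
  so those of points of the closure are approximated by those of points of the orbit. Along
  the orbit, the displacement over \<open>n\<close> steps differs from the sum of \<open>s\<close> over a window by \<open>c
  (k + n) - c k\<close>, which is bounded.
\<close>
lemma rotation_set_orbit_closure:
  assumes F: "lattice_equivariant F" "continuous_on UNIV F"
    and s: "\<And>n. integral_vector (s n)" and orbit: "\<And>n. F (c n) = c (n + 1) + s n"
    and bounded: "\<And>n. norm (c n) \<le> 1"
  shows "rotation_set (closure (range (\<lambda>n. torus_proj (c n)))) F = window_limits s"
proof (intro equalityI subsetI)
  define M where "M = closure (range (\<lambda>n. torus_proj (c n)))"
  have iter: "(F ^^ n) (c k) - c k = sum s {k..<k + int n} + (c (k + int n) - c k)" for n k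
    using iterate_along_orbit[of F s c, OF F(1) s orbit] by simp
  have c_diff: "norm (c i - c j) \<le> 2" for i j
    using norm_triangle_ineq4[of "c i" "c j"] bounded[of i] bounded[of j] by linarith
  {
    fix \<rho> assume "\<rho> \<in> rotation_set (closure (range (\<lambda>n. torus_proj (c n)))) F"
    then obtain n z where nz: "strict_mono n" "\<And>i. torus_proj (z i) \<in> M"
      "(\<lambda>i. ((F ^^ n i) (z i) - z i) /\<^sub>R real (n i)) \<longlonglongrightarrow> \<rho>"
      by (auto simp: rotation_set_def M_def)
    show "\<rho> \<in> window_limits s"
    proof (rule window_limitsI)
      fix e :: real and N :: nat
      assume e: "e > 0"
      obtain i0 where i0: "\<And>i. i \<ge> i0 \<Longrightarrow> norm (((F ^^ n i) (z i) - z i) /\<^sub>R real (n i) - \<rho>) < e / 2"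
        using LIMSEQ_D[OF nz(3), of "e / 2"] e by auto
      (* the displacement is off by at most 3, hence the average by at most e / 2 as soon as n i is at least 6 / e *)
      define i where "i = max i0 (max (Suc N) (nat \<lceil>6 / e\<rceil>))"
      define m where "m = n i"
      have "i \<le> m" unfolding m_def using nz(1) by (rule seq_suble)
      then have m: "m \<ge> N" "m > 0" "6 / e \<le> m"
        unfolding i_def by (auto simp: max_def split: if_splits) linarith+
      define U where "U = {w. norm (((F ^^ m) w - w) - ((F ^^ m) (z i) - z i)) < 1}"
      have "open U"
        unfolding U_def
        by (intro open_Collect_less continuous_intros continuous_on_iterate F(2))
      then have "open (torus_proj ` U)" by (rule open_image_torus_proj)
      moreover have "torus_proj (z i) \<in> torus_proj ` U" by (simp add: U_def)
      moreover have "torus_proj (z i) \<in> closure (range (\<lambda>n. torus_proj (c n)))"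
        using nz(2) by (simp add: M_def)
      ultimately have "torus_proj ` U \<inter> range (\<lambda>n. torus_proj (c n)) \<noteq> {}"
        using open_Int_closure_eq_empty[of "torus_proj ` U" "range (\<lambda>n. torus_proj (c n))"] by auto
      then obtain t where t: "t \<in> torus_proj ` U" "t \<in> range (\<lambda>n. torus_proj (c n))" by blast
      from t(2) obtain k where "t = torus_proj (c k)" by auto
      with t(1) have "torus_proj (c k) \<in> torus_proj ` U" by simp
      then obtain w where w: "w \<in> U" "torus_proj w = torus_proj (c k)" by auto
      then obtain p where p: "integral_vector p" "w = c k + p"
        using torus_proj_eq_translate by auto
      have "(F ^^ m) w - w = (F ^^ m) (c k) - c k"
        using lattice_equivariant_iterate[OF F(1) p(1)] p(2) by simp
      then have "norm ((sum s {k..<k + int m} + (c (k + int m) - c k)) - ((F ^^ m) (z i) - z i)) < 1"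
        using w(1) by (simp add: U_def iter)
      then have "norm (sum s {k..<k + int m} - ((F ^^ m) (z i) - z i)) \<le> 3"
        using c_diff[of "k + int m" k]
          norm_triangle_ineq4[of "sum s {k..<k + int m} + (c (k + int m) - c k) - ((F ^^ m) (z i) - z i)"
            "c (k + int m) - c k"]
        by (simp add: algebra_simps)
      then have "norm (sum s {k..<k + int m} /\<^sub>R real m - ((F ^^ m) (z i) - z i) /\<^sub>R real m) \<le> 3 / real m"
        using m(2) by (rule norm_scaled_le)
      also have "3 / real m \<le> e / 2" using m(2,3) e by (simp add: field_simps)
      finally have 1: "norm (sum s {k..<k + int m} /\<^sub>R real m - ((F ^^ m) (z i) - z i) /\<^sub>R real m) \<le> e / 2" .
      have 2: "norm (((F ^^ m) (z i) - z i) /\<^sub>R real m - \<rho>) < e / 2"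
        unfolding m_def by (rule i0) (simp add: i_def)
      have "norm (sum s {k..<k + int m} /\<^sub>R real m - \<rho>) < e"
        using 1 2 norm_triangle_ineq[of "sum s {k..<k + int m} /\<^sub>R real m - ((F ^^ m) (z i) - z i) /\<^sub>R real m"
            "((F ^^ m) (z i) - z i) /\<^sub>R real m - \<rho>"] by simp
      then show "\<exists>n\<ge>N. \<exists>u. n > 0 \<and> norm (sum s {u..<u + int n} /\<^sub>R real n - \<rho>) < e"
        using m by blast
    qed
  next
    fix \<rho> assume \<rho>: "\<rho> \<in> window_limits s"
    define P where "P i n \<longleftrightarrow> n > 0 \<and> i \<le> n \<and> (\<exists>u. norm (sum s {u..<u + int n} /\<^sub>R real n - \<rho>) < 1 / real (Suc i))" for i n
    have step: "\<exists>n>N. P i n" for N i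
    proof -
      obtain n u where "n \<ge> max i (Suc N)" "n > 0" "norm (sum s {u..<u + int n} /\<^sub>R real n - \<rho>) < 1 / real (Suc i)"
        by (rule window_limitsE[OF \<rho>, of "1 / real (Suc i)" "max i (Suc N)"]) auto
      then show ?thesis unfolding P_def by (intro exI[of _ n]) auto
    qed
    have "\<exists>n. \<forall>i. P i (n i) \<and> n i < n (Suc i)"
    proof (rule dependent_nat_choice)
      show "\<exists>x. P 0 x" using step by blast
      show "\<exists>y. P (Suc i) y \<and> x < y" for x i using step[of x "Suc i"] by blast
    qed
    then obtain n where n: "\<And>i. P i (n i)" "\<And>i. n i < n (Suc i)" by blast
    have "\<forall>i. \<exists>u. norm (sum s {u..<u + int (n i)} /\<^sub>R real (n i) - \<rho>) < 1 / real (Suc i)"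
      using n(1) unfolding P_def by blast
    from choice[OF this] obtain u
      where u: "\<And>i. norm (sum s {u i..<u i + int (n i)} /\<^sub>R real (n i) - \<rho>) < 1 / real (Suc i)"
      by blast
    have n_pos: "n i > 0" and n_ge: "i \<le> n i" for i using n(1)[of i] by (simp_all add: P_def)
    have "norm (((F ^^ n i) (c (u i)) - c (u i)) /\<^sub>R real (n i) - \<rho>) \<le> 2 / real (n i) + 1 / real (Suc i)" for i
    proof -
      have "norm (((F ^^ n i) (c (u i)) - c (u i)) - sum s {u i..<u i + int (n i)}) \<le> 2"
        unfolding iter using c_diff by simp
      from norm_scaled_le[OF this n_pos[of i]] u[of i] norm_triangle_ineq[of
            "((F ^^ n i) (c (u i)) - c (u i)) /\<^sub>R real (n i) - sum s {u i..<u i + int (n i)} /\<^sub>R real (n i)"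
            "sum s {u i..<u i + int (n i)} /\<^sub>R real (n i) - \<rho>"]
      show ?thesis unfolding diff_add_cancel add_diff_eq by linarith
    qed
    moreover have "2 / real (n i) + 1 / real (Suc i) \<le> 5 / real (Suc i)" for i
    proof -
      have "real (Suc i) \<le> 2 * real (n i)" using n_pos[of i] n_ge[of i] by linarith
      then have "2 / real (n i) \<le> 4 / real (Suc i)"
        using n_pos[of i] by (simp add: divide_le_eq pos_le_divide_eq)
      moreover have "5 / real (Suc i) = 4 / real (Suc i) + 1 / real (Suc i)"
        by (simp flip: add_divide_distrib)
      ultimately show ?thesis by linarith
    qed
    ultimately have error: "norm (((F ^^ n i) (c (u i)) - c (u i)) /\<^sub>R real (n i) - \<rho>) \<le> 5 / real (Suc i)" for i
      by (rule order_trans)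
    have "(\<lambda>i. 5 / real (Suc i)) \<longlonglongrightarrow> 0"
      using LIMSEQ_Suc[OF lim_const_over_n[of "5::real"]] by simp
    then have "(\<lambda>i. ((F ^^ n i) (c (u i)) - c (u i)) /\<^sub>R real (n i) - \<rho>) \<longlonglongrightarrow> 0"
      by (rule Lim_null_comparison[OF always_eventually[OF allI[OF error]]])
    then have "(\<lambda>i. ((F ^^ n i) (c (u i)) - c (u i)) /\<^sub>R real (n i)) \<longlonglongrightarrow> \<rho>"
      by (rule LIM_zero_cancel)
    moreover have "strict_mono n" using n(2) by (simp add: strict_mono_Suc_iff)
    moreover have "torus_proj (c (u i)) \<in> M" for i
      unfolding M_def by (rule closure_subset[THEN subsetD]) simp
    ultimately show "\<rho> \<in> rotation_set (closure (range (\<lambda>n. torus_proj (c n)))) F"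
      unfolding rotation_set_def M_def[symmetric]
      by (intro CollectI exI[of _ n] exI[of _ "\<lambda>i. c (u i)"] conjI allI vimageI2)
  }
qed

section \<open>Coding orbits by integer sequences\<close>

lemma norm_le_components: "norm (v :: real^2) \<le> \<bar>v $ 1\<bar> + \<bar>v $ 2\<bar>"
  using norm_le_l1_cart[of v] by (simp add: sum_2)

text \<open>
  Unrolling the equation forward in time gives a geometric series.
\<close>
lemma bounded_backward_solution:
  fixes r :: "int \<Rightarrow> real"
  assumes r: "\<And>j. \<bar>r j\<bar> \<le> B" and \<kappa>: "\<bar>\<kappa>\<bar> < 1"
  shows "\<exists>a. \<forall>j. a j = r j + \<kappa> * a (j + 1) \<and> \<bar>a j\<bar> \<le> B / (1 - \<bar>\<kappa>\<bar>)"
proof (intro exI allI conjI)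
  define a where "a j = (\<Sum>i. \<kappa> ^ i * r (j + int i))" for j
  fix j
  have norm: "norm (\<kappa> ^ i * r (j + int i)) \<le> B * \<bar>\<kappa>\<bar> ^ i" for i j
    using mult_left_mono[OF r[of "j + int i"], of "\<bar>\<kappa>\<bar> ^ i"] by (simp add: abs_mult power_abs mult.commute)
  have geo: "(\<lambda>i. B * \<bar>\<kappa>\<bar> ^ i) sums (B * (1 / (1 - \<bar>\<kappa>\<bar>)))"
    using \<kappa> by (intro sums_mult geometric_sums) simp
  have summable: "summable (\<lambda>i. \<kappa> ^ i * r (j + int i))" for j
    using norm by (intro summable_comparison_test'[OF sums_summable[OF geo]])
  have "(\<Sum>i. \<kappa> ^ Suc i * r (j + int (Suc i))) = a j - \<kappa> ^ 0 * r (j + int 0)"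
    unfolding a_def by (rule suminf_split_head[OF summable])
  moreover have "(\<Sum>i. \<kappa> ^ Suc i * r (j + int (Suc i))) = \<kappa> * a (j + 1)"
    unfolding a_def using suminf_mult[OF summable[of "j + 1"], of \<kappa>] by (simp add: mult_ac add_ac)
  ultimately show "a j = r j + \<kappa> * a (j + 1)" by simp
  have "norm (a j) \<le> (\<Sum>i. B * \<bar>\<kappa>\<bar> ^ i)"
    unfolding a_def by (rule norm_suminf_le[OF norm sums_summable[OF geo]])
  then show "\<bar>a j\<bar> \<le> B / (1 - \<bar>\<kappa>\<bar>)" by (simp add: sums_unique[OF geo, symmetric])
qed

definition shear :: real where "shear = 11 - 1 / 11"

text \<open>
  With the shift \<open>E\<close> and \<open>\<lambda> = 11\<close>, the recurrence is \<open>(\<lambda> - 1/\<lambda> - E + E\<^sup>-\<^sup>1) v = r\<close>, and the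
  operator on the left is the product of \<open>\<lambda> - E\<close> and \<open>1 + E\<^sup>-\<^sup>1/\<lambda>\<close>. Each factor is inverted on
  bounded sequences by a geometric series, the second one after reversing time. The bound \<open>4/\<lambda>
  / (1 - 1/\<lambda>)\<^sup>2 = 11/25\<close> obtained in this way puts the solution into \<open>[0, 1/2]\<close>.
\<close>
lemma recurrence_solution:
  fixes r :: "int \<Rightarrow> real"
  assumes r: "\<And>j. r j \<in> {1..4}"
  shows "\<exists>v. \<forall>j. shear * v j = r j + v (j + 1) - v (j - 1) \<and> v j \<in> {0..1/2}"
proof -
  have "\<exists>a. \<forall>j. a j = r j / 11 + 1 / 11 * a (j + 1) \<and> \<bar>a j\<bar> \<le> 4 / 11 / (1 - \<bar>1 / 11\<bar>)"
  proof (rule bounded_backward_solution)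
    show "\<bar>r j / 11\<bar> \<le> 4 / 11" for j using r[of j] by simp
  qed simp
  then obtain a where a0: "\<forall>j. a j = r j / 11 + 1 / 11 * a (j + 1) \<and> \<bar>a j\<bar> \<le> 4 / 11 / (1 - \<bar>1 / 11\<bar>)"
    by (rule exE)
  have a: "a j = r j / 11 + 1 / 11 * a (j + 1)" for j
    by (rule conjunct1[OF a0[rule_format, of j]])
  have a_bound: "\<bar>a j\<bar> \<le> 2 / 5" for j
    using conjunct2[OF a0[rule_format, of j]] by simp
  have "\<exists>w. \<forall>j. w j = a (- j) + (- 1 / 11) * w (j + 1) \<and> \<bar>w j\<bar> \<le> 2 / 5 / (1 - \<bar>- 1 / 11\<bar>)"
    by (rule bounded_backward_solution[of "\<lambda>j. a (- j)", OF a_bound]) simp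
  then obtain w where w0: "\<forall>j. w j = a (- j) + (- 1 / 11) * w (j + 1) \<and> \<bar>w j\<bar> \<le> 2 / 5 / (1 - \<bar>- 1 / 11\<bar>)"
    by (rule exE)
  have w: "w j = a (- j) + (- 1 / 11) * w (j + 1)" for j
    by (rule conjunct1[OF w0[rule_format, of j]])
  have w_bound: "\<bar>w j\<bar> \<le> 11 / 25" for j
    using conjunct2[OF w0[rule_format, of j]] by simp
  define v where "v j = w (- j)" for j
  have v: "v j = a j - 1 / 11 * v (j - 1)" for j
    using w[of "- j"] by (simp add: v_def algebra_simps)
  have eq: "shear * v j = r j + v (j + 1) - v (j - 1)" for j
    using v[of j] v[of "j + 1"] a[of j] unfolding shear_def left_diff_distrib by simp
  have "v j \<in> {0..1/2}" for j
  proof -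
    have "\<bar>v i\<bar> \<le> 11 / 25" for i using w_bound[of "- i"] by (simp add: v_def)
    from this[of "j + 1"] this[of "j - 1"] have "\<bar>v (j + 1) - v (j - 1)\<bar> \<le> 22 / 25" by linarith
    moreover have "1 \<le> r j" "r j \<le> 4" using r[of j] by auto
    ultimately have "0 \<le> shear * v j" "shear * v j \<le> 122 / 25" using eq[of j] by linarith+
    then show ?thesis by (simp add: shear_def)
  qed
  with eq show ?thesis by blast
qed

text \<open>
  Where the right-hand sides agree, the difference of the two solutions is at most \<open>2 / L \<le>
  1/5\<close> times its maximum over the two neighbouring places.
\<close>
lemma recurrence_stability:
  fixes v v' :: "int \<Rightarrow> real"
  assumes v: "\<And>j. shear * v j = r j + v (j + 1) - v (j - 1)" "\<And>j. v j \<in> {0..1/2}"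
    and v': "\<And>j. shear * v' j = r' j + v' (j + 1) - v' (j - 1)" "\<And>j. v' j \<in> {0..1/2}"
    and agree: "\<And>j. \<bar>j\<bar> \<le> int N \<Longrightarrow> r j = r' j"
    and n: "n \<le> N" "\<bar>j\<bar> \<le> int (N - n)"
  shows "\<bar>v j - v' j\<bar> \<le> (1 / 5) ^ n"
  using n
proof (induction n arbitrary: j)
  case 0
  then show ?case using v(2)[of j] v'(2)[of j] by auto
next
  case (Suc n)
  have "\<bar>v (j + 1) - v' (j + 1)\<bar> \<le> (1 / 5) ^ n" "\<bar>v (j - 1) - v' (j - 1)\<bar> \<le> (1 / 5) ^ n"
    using Suc.prems by (auto intro!: Suc.IH)
  moreover have "r j = r' j" using Suc.prems by (intro agree) auto
  then have "shear * (v j - v' j) = (v (j + 1) - v' (j + 1)) - (v (j - 1) - v' (j - 1))"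
    using v(1)[of j] v'(1)[of j] by (simp add: algebra_simps)
  ultimately have "\<bar>shear * (v j - v' j)\<bar> \<le> 2 * (1 / 5) ^ n" by linarith
  then have "shear * \<bar>v j - v' j\<bar> \<le> 2 * (1 / 5) ^ n" by (simp only: abs_mult) (simp add: shear_def)
  moreover have "10 * \<bar>v j - v' j\<bar> \<le> shear * \<bar>v j - v' j\<bar>"
    by (intro mult_right_mono) (simp_all add: shear_def)
  ultimately have "10 * \<bar>v j - v' j\<bar> \<le> 2 * (1 / 5) ^ n" by (rule order_trans[rotated])
  then show ?case by simp
qed

lemma vec2_eq_iff: "(z :: real^2) = w \<longleftrightarrow> z $ 1 = w $ 1 \<and> z $ 2 = w $ 2"
  by (simp add: vec_eq_iff forall_2)

text \<open>
  The distance to the nearest integer, a triangle wave.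
\<close>
definition fold_wave :: "real \<Rightarrow> real" where
  "fold_wave y = arccos (cos (2 * pi * y)) / (2 * pi)"

lemma continuous_fold_wave [continuous_intros]:
  fixes g :: "'a::t2_space \<Rightarrow> real"
  assumes "continuous_on S g"
  shows "continuous_on S (\<lambda>z. fold_wave (g z))"
  unfolding fold_wave_def
  by (intro continuous_on_divide continuous_on_arccos continuous_on_cos continuous_on_mult
      continuous_on_const assms) auto

lemma fold_wave_id: "y \<in> {0..1/2} \<Longrightarrow> fold_wave y = y"
  by (simp add: fold_wave_def arccos_cos)

lemma fold_wave_periodic:
  assumes "k \<in> \<int>"
  shows "fold_wave (y + k) = fold_wave y"
proof -
  obtain n where n: "k = of_int n" using assms by (rule Ints_cases)
  have "cos (2 * pi * (y + k)) = cos (2 * pi * y)"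
    using sin_cos_eq_iff[of "2 * pi * (y + k)" "2 * pi * y"] by (auto simp: n algebra_simps)
  then show ?thesis by (simp add: fold_wave_def)
qed

definition shear_lift :: "real^2 \<Rightarrow> real^2" where
  "shear_lift z = (let x = z $ 1 + shear * fold_wave (z $ 2) in
     vector [x, z $ 2 + shear * fold_wave x])"

definition shear_lift_inv :: "real^2 \<Rightarrow> real^2" where
  "shear_lift_inv z = (let y = z $ 2 - shear * fold_wave (z $ 1) in
     vector [z $ 1 - shear * fold_wave y, y])"

lemma shear_lift_inverse: "shear_lift_inv (shear_lift z) = z" "shear_lift (shear_lift_inv z) = z"
  by (simp_all add: vec2_eq_iff shear_lift_def shear_lift_inv_def Let_def)

lemma continuous_on_vector2:
  assumes "continuous_on S f" "continuous_on S g"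
  shows "continuous_on S (\<lambda>z. vector [f z, g z] :: real^2)"
proof -
  have "continuous_on S (\<lambda>z. (\<chi> i. vector [f z, g z] $ i) :: real^2)"
  proof (rule continuous_on_vec_lambda)
    fix i :: 2
    show "continuous_on S (\<lambda>z. (vector [f z, g z] :: real^2) $ i)"
      using exhaust_2[of i] assms by auto
  qed
  then show ?thesis by simp
qed

lemma continuous_shear_lift: "continuous_on UNIV shear_lift" "continuous_on UNIV shear_lift_inv"
  unfolding shear_lift_def shear_lift_inv_def Let_def
  by (intro continuous_on_vector2 continuous_intros)+

lemma equivariant_shear_lift: "lattice_equivariant shear_lift" "lattice_equivariant shear_lift_inv"
proof -
  have shift: "fold_wave (a + k $ i) = fold_wave a" "fold_wave (a + k $ i + b) = fold_wave (a + b)"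
    "fold_wave (a + k $ i - b) = fold_wave (a - b)" if "integral_vector k" for a b k i
  proof -
    have k: "k $ i \<in> \<int>" using that by (simp add: integral_vector_def)
    show "fold_wave (a + k $ i) = fold_wave a" by (rule fold_wave_periodic[OF k])
    show "fold_wave (a + k $ i + b) = fold_wave (a + b)"
      using fold_wave_periodic[OF k, of "a + b"] by (simp add: add_ac)
    show "fold_wave (a + k $ i - b) = fold_wave (a - b)"
      using fold_wave_periodic[OF k, of "a - b"] by (simp add: algebra_simps)
  qed
  show "lattice_equivariant shear_lift" "lattice_equivariant shear_lift_inv"
    by (simp_all add: lattice_equivariant_def vec2_eq_iff shear_lift_def shear_lift_inv_def Let_def shift)
qed

text \<open>
  The two coordinates of \<open>s\<close> are interleaved into one sequence \<open>r\<close>, so that the solution \<open>v\<close>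
  of the recurrence contains the first coordinates of the orbit at even places and the second
  ones at odd places. As \<open>v\<close> stays in \<open>[0, 1/2]\<close>, where the wave is the identity, the
  recurrence says exactly that \<open>c\<close> is mapped to its successor up to the translation by \<open>s\<close>.
\<close>
lemma coded_minimal_set:
  fixes s :: "int \<Rightarrow> real^2"
  assumes s: "\<And>t i. s t $ i \<in> \<int>" "\<And>t i. s t $ i \<in> {1..4}" and recurrent: "uniformly_recurrent s"
  shows "\<exists>M. minimal_set (induced_map shear_lift) M \<and> rotation_set M shear_lift = window_limits s"
proof -
  define r where "r j = (if odd j then s (j div 2) $ 1 else s (j div 2 - 1) $ 2)" for j :: int
  have "r j \<in> {1..4}" for j using s(2) by (simp add: r_def)
  from recurrence_solution[of r, OF this] obtain v where
    v: "\<And>j. shear * v j = r j + v (j + 1) - v (j - 1)" "\<And>j. v j \<in> {0..1/2}" by blast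
  define c :: "int \<Rightarrow> real^2" where "c n = vector [v (2 * n), v (2 * n + 1)]" for n
  have fold: "fold_wave (v j) = v j" for j by (rule fold_wave_id[OF v(2)])
  have orbit: "shear_lift (c n) = c (n + 1) + s n" for n
  proof -
    have "r (2 * n + 1) = s n $ 1" "r (2 * n + 2) = s n $ 2" by (simp_all add: r_def)
    then have 1: "shear * v (2 * n + 1) = s n $ 1 + v (2 * n + 2) - v (2 * n)"
      and 2: "shear * v (2 * n + 2) = s n $ 2 + v (2 * n + 3) - v (2 * n + 1)"
      using v(1)[of "2 * n + 1"] v(1)[of "2 * n + 2"] by (simp_all add: add.commute)
    have "v (2 * n) + shear * fold_wave (v (2 * n + 1)) = v (2 * n + 2) + s n $ 1"
      using 1 by (simp add: fold)
    moreover have "fold_wave (v (2 * n + 2) + s n $ 1) = v (2 * n + 2)"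
      by (simp add: fold_wave_periodic[OF s(1)] fold)
    ultimately show ?thesis
      using 2 by (simp add: vec2_eq_iff shear_lift_def Let_def c_def add.commute[of _ 2] algebra_simps)
  qed
  have bounded: "norm (c n) \<le> 1" for n
    using norm_le_components[of "c n"] v(2)[of "2 * n"] v(2)[of "2 * n + 1"] by (simp add: c_def)
  have integral: "integral_vector (s n)" for n using s(1) by (simp add: integral_vector_def)
  have close: "\<exists>P>0. \<forall>i. norm (c (i * P) - c 0) < e" if e: "e > 0" for e
  proof -
    obtain n where n: "(1 / 5 :: real) ^ n < e / 2"
      using real_arch_pow_inv[of "e / 2" "1 / 5"] e by auto
    (* stability is needed at the places 0 and 1, the latter costing one step of the radius *)
    define N where "N = Suc n"
    obtain P where P: "P > 0" "\<And>i t. \<bar>t\<bar> \<le> int N + 1 \<Longrightarrow> s (t + i * P) = s t"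
      using recurrent unfolding uniformly_recurrent_def by blast
    have "norm (c (i * P) - c 0) < e" for i
    proof -
      define v' where "v' j = v (j + 2 * (i * P))" for j
      define r' where "r' j = r (j + 2 * (i * P))" for j
      have v': "shear * v' j = r' j + v' (j + 1) - v' (j - 1)" "v' j \<in> {0..1/2}" for j
        using v(1)[of "j + 2 * (i * P)"] v(2)[of "j + 2 * (i * P)"]
        by (simp_all add: v'_def r'_def algebra_simps)
      have agree: "r' j = r j" if "\<bar>j\<bar> \<le> int N" for j
      proof -
        have 1: "odd (j + 2 * (i * P)) \<longleftrightarrow> odd j" "(j + 2 * (i * P)) div 2 = j div 2 + i * P"
          by simp_all
        have 2: "\<bar>j div 2\<bar> \<le> int N + 1" "\<bar>j div 2 - 1\<bar> \<le> int N + 1"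
          using that by presburger+
        have "s (j div 2 - 1 + i * P) = s (j div 2 - 1)" if "even j" using P(2) 2 that by blast
        moreover have "s (j div 2 + i * P) = s (j div 2)" if "odd j" using P(2) 2 that by blast
        ultimately show ?thesis unfolding r'_def r_def 1 by (simp add: algebra_simps)
      qed
      have "\<bar>v' j - v j\<bar> \<le> (1 / 5) ^ n" if "\<bar>j\<bar> \<le> 1" for j
        using recurrence_stability[OF v' v agree, of N n j] that by (simp add: N_def)
      from this[of 0] this[of 1] show ?thesis
        using norm_le_components[of "c (i * P) - c 0"] n
        by (simp add: c_def v'_def add.commute)
    qed
    with P(1) show ?thesis by blast
  qed
  have "minimal_set (induced_map shear_lift) (closure (range (\<lambda>n. torus_proj (c n))))"
  proof (rule orbit_closure_minimal[OF compact_torus])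
    show "homeomorphism UNIV UNIV (induced_map shear_lift) (induced_map shear_lift_inv)"
      by (intro homeomorphism_induced_map equivariant_shear_lift continuous_shear_lift shear_lift_inverse)
    show "induced_map shear_lift (torus_proj (c n)) = torus_proj (c (n + 1))" for n
      using integral by (simp add: induced_map_proj equivariant_shear_lift orbit)
    show "\<exists>P>0. \<forall>i. torus_proj (c (i * P)) \<in> U" if U: "open U" "torus_proj (c 0) \<in> U" for U
    proof -
      have "open (torus_proj -` U)" using U(1) by (simp add: open_torus_def)
      then obtain e where e: "e > 0" "ball (c 0) e \<subseteq> torus_proj -` U"
        using U(2) by (meson open_contains_ball vimageI2)
      obtain P where P: "P > 0" "\<forall>i. norm (c (i * P) - c 0) < e" using close[OF e(1)] by blast
      have "torus_proj (c (i * P)) \<in> U" for i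
      proof -
        have "c (i * P) \<in> ball (c 0) e" using P(2) by (simp add: dist_norm norm_minus_commute)
        with e(2) show ?thesis by blast
      qed
      with P(1) show ?thesis by blast
    qed
  qed
  moreover have "rotation_set (closure (range (\<lambda>n. torus_proj (c n)))) shear_lift = window_limits s"
    by (intro rotation_set_orbit_closure equivariant_shear_lift continuous_shear_lift integral orbit bounded)
  ultimately show ?thesis by blast
qed

section \<open>Centred blocks of integers\<close>

text \<open>
  The value of \<open>t / l\<close> rounded to the nearest integer. For odd \<open>l\<close> the sites with index \<open>j\<close>
  form the block of length \<open>l\<close> centred at \<open>l * j\<close>.
\<close>
definition block_index :: "int \<Rightarrow> int \<Rightarrow> int" where
  "block_index l t = (2 * t + l) div (2 * l)"

lemma block_index_eqI:
  assumes "2 * \<bar>r\<bar> < l"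
  shows "block_index l (l * j + r) = j"
proof -
  have "2 * (l * j + r) + l = (2 * r + l) + j * (2 * l)"
    by (simp add: algebra_simps)
  then have "block_index l (l * j + r) = (2 * r + l) div (2 * l) + j"
    unfolding block_index_def using assms by (metis add.commute div_mult_self1 abs_ge_zero mult_eq_0_iff
        not_less zero_neq_numeral mult_nonneg_nonneg zero_le_numeral)
  moreover have "(2 * r + l) div (2 * l) = 0"
    using assms by (intro div_pos_pos_trivial) auto
  ultimately show ?thesis by simp
qed

lemma block_index_remainder:
  assumes "odd l" "l > 0"
  shows "2 * \<bar>t - l * block_index l t\<bar> < l"
proof -
  define b where "b = block_index l t"
  have eq: "2 * t + l = 2 * l * b + (2 * t + l) mod (2 * l)"
    unfolding b_def block_index_def by simp
  have "0 \<le> (2 * t + l) mod (2 * l)" "(2 * t + l) mod (2 * l) < 2 * l"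
    using assms by auto
  then have "0 \<le> 2 * (t - l * b) + l" "2 * (t - l * b) + l < 2 * l"
    using eq by (auto simp: algebra_simps)
  moreover have "2 * (t - l * b) + l \<noteq> 0"
    using assms(1) by presburger
  ultimately show ?thesis
    unfolding b_def by linarith
qed

lemma abs_block_index_less:
  assumes "odd m" "m > 1" "j \<noteq> 0"
  shows "\<bar>block_index m j\<bar> < \<bar>j\<bar>"
proof (rule ccontr)
  assume "\<not> \<bar>block_index m j\<bar> < \<bar>j\<bar>"
  then have le: "\<bar>j\<bar> \<le> \<bar>block_index m j\<bar>" by simp
  have "m \<ge> 3" using assms by presburger
  have rem: "2 * \<bar>j - m * block_index m j\<bar> < m" using block_index_remainder[of m j] assms by simp
  have "m * \<bar>block_index m j\<bar> \<le> \<bar>j\<bar> + \<bar>j - m * block_index m j\<bar>"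
    using \<open>m \<ge> 3\<close> abs_mult[of m "block_index m j"] by linarith
  moreover have "2 * M < 2 * B + m" if "M \<le> J + R" "2 * R < m" "J \<le> B" for M J R B :: int
    using that by linarith
  ultimately have "2 * (m * \<bar>block_index m j\<bar>) < 2 * \<bar>block_index m j\<bar> + m"
    using rem le by blast
  then have "2 * (m - 1) * \<bar>block_index m j\<bar> < m" by (simp add: algebra_simps)
  moreover have "2 * (m - 1) * 1 \<le> 2 * (m - 1) * \<bar>block_index m j\<bar>"
    using \<open>m \<ge> 3\<close> le assms(3) by (intro mult_left_mono) auto
  ultimately have "2 * (m - 1) * 1 < m" by (rule le_less_trans[rotated])
  then have "2 * m < m + 2" by simp
  then show False using \<open>m \<ge> 3\<close> by simp
qed

text \<open>
  The ratio of consecutive block lengths is odd, so that there is a central subblock, and it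
  grows exponentially, so that the frequency of central subblocks decays geometrically with
  the level.
\<close>
fun block_len :: "nat \<Rightarrow> int" where
  "block_len 0 = 1"
| "block_len (Suc K) = 3 ^ Suc K * block_len K"

lemma block_len_pos: "block_len K > 0" by (induction K) auto
lemma odd_block_len: "odd (block_len K)" by (induction K) auto
lemma block_len_ge: "3 ^ K \<le> block_len K"
proof (induction K)
  case (Suc K)
  have "(3::int) ^ Suc K * 1 \<le> 3 ^ Suc K * block_len K"
    using block_len_pos[of K] by (intro mult_left_mono) auto
  then show ?case by simp
qed simp

declare block_len.simps(2) [simp del]

lemma sum_int_split:
  fixes f :: "int \<Rightarrow> 'a::comm_monoid_add"
  assumes "a \<le> b" "b \<le> c"
  shows "sum f {a..<c} = sum f {a..<b} + sum f {b..<c}"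
  using assms by (subst sum.union_disjoint[symmetric]) (auto simp: ivl_disj_un)

lemma norm_sum_int_le:
  fixes f :: "int \<Rightarrow> 'a::real_normed_vector"
  assumes "a \<le> b" "\<And>t. a \<le> t \<Longrightarrow> t < b \<Longrightarrow> norm (f t) \<le> e"
  shows "norm (sum f {a..<b}) \<le> real_of_int (b - a) * e"
  using sum_norm_bound[of "{a..<b}" f e] assms by simp

definition block_half :: "nat \<Rightarrow> int" where
  "block_half K = (block_len K - 1) div 2"

definition block_start :: "nat \<Rightarrow> int \<Rightarrow> int" where
  "block_start K j = block_len K * j - block_half K"

lemma block_len_block_half: "block_len K = 2 * block_half K + 1"
  using odd_block_len[of K] by (simp add: block_half_def)

lemma block_start_Suc_index: "block_start K (j + 1) = block_start K j + block_len K"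
  by (simp add: block_start_def algebra_simps)

lemma block_start_mono: "i \<le> j \<Longrightarrow> block_start K i \<le> block_start K j"
  using block_len_pos[of K] by (simp add: block_start_def)

text \<open>
  Centred blocks of consecutive levels are nested: a block of level \<open>K + 1\<close> starts where the
  leftmost of its subblocks does.
\<close>
lemma block_start_level:
  assumes "(3::int) ^ Suc K = 2 * r + 1"
  shows "block_start (Suc K) i = block_start K (3 ^ Suc K * i - r)"
proof -
  have "block_len (Suc K) = (2 * r + 1) * (2 * block_half K + 1)"
    using assms block_len_block_half[of K] by (simp only: block_len.simps)
  then have "2 * block_half (Suc K) = 2 * (r * block_len K + block_half K)"
    using block_len_block_half[of K] block_len_block_half[of "Suc K"] by (simp add: algebra_simps)
  then have "block_half (Suc K) = r * block_len K + block_half K" by simp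
  then show ?thesis by (simp add: block_start_def block_len.simps algebra_simps)
qed

lemma near_multiple_iff:
  "2 * \<bar>t - block_len K * j\<bar> < block_len K \<longleftrightarrow> block_start K j \<le> t \<and> t < block_start K (j + 1)"
proof -
  define p where "p = block_len K * j"
  have "2 * \<bar>t - p\<bar> < block_len K \<longleftrightarrow> p - block_half K \<le> t \<and> t < p - block_half K + block_len K"
    using block_len_block_half[of K] by presburger
  then show ?thesis
    unfolding block_start_Suc_index unfolding block_start_def p_def .
qed

lemma block_index_bounds: "block_start K (block_index (block_len K) t) \<le> t \<and> t < block_start K (block_index (block_len K) t + 1)"
  unfolding near_multiple_iff[symmetric] by (rule block_index_remainder[OF odd_block_len block_len_pos])

lemma block_index_eq_iff: "block_index (block_len K) t = j \<longleftrightarrow> block_start K j \<le> t \<and> t < block_start K (j + 1)"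
proof
  assume "block_start K j \<le> t \<and> t < block_start K (j + 1)"
  then have "2 * \<bar>t - block_len K * j\<bar> < block_len K" by (simp add: near_multiple_iff)
  from block_index_eqI[OF this, of j] show "block_index (block_len K) t = j" by simp
qed (use block_index_bounds in blast)

lemma block_index_mono:
  assumes "0 < l" "s \<le> t"
  shows "block_index l s \<le> block_index l t"
  using assms by (auto simp: block_index_def intro!: zdiv_mono1)

lemma block_index_diff_bound: "block_len K * (block_index (block_len K) t - block_index (block_len K) s) < t - s + block_len K"
  using block_index_bounds[of K t] block_index_bounds[of K s] by (simp add: block_start_def algebra_simps)

lemma sum_over_blocks:
  fixes f :: "int \<Rightarrow> 'a::comm_monoid_add"
  assumes "i \<le> j"
  shows "sum f {block_start K i..<block_start K j} = (\<Sum>k = i..<j. sum f {block_start K k..<block_start K (k + 1)})"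
  using assms
proof (induction j rule: int_ge_induct)
  case base
  then show ?case by simp
next
  case (step j)
  have "{i..<j + 1} = insert j {i..<j}" using step by auto
  then show ?case
    using step sum_int_split[of "block_start K i" "block_start K j" "block_start K (j + 1)" f]
    by (simp add: block_start_mono add.commute)
qed

lemma level_odd: "\<exists>r>0. (3::int) ^ Suc K = 2 * r + 1"
proof -
  have "odd ((3::int) ^ Suc K)" by simp
  then obtain r where "(3::int) ^ Suc K = 2 * r + 1" by (blast elim: oddE)
  moreover have "(3::int) ^ Suc K > 1" by (rule one_less_power) auto
  ultimately show ?thesis by (intro exI[of _ r]) auto
qed

section \<open>Block totals of a recurrent sequence\<close>

text \<open>
  Distribution of a total \<open>X\<close> over the \<open>m\<close> subblocks with positions \<open>- (m - 1) / 2, \<dots>, (m - 1)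
  / 2\<close>: the central one gets the fixed amount \<open>c\<close>, the others get increments of the floor of a
  linear function of slope \<open>(X - c) / (m - 1)\<close>. Such increments are integers within \<open>1\<close> of the
  slope, and they telescope to the exact total.
\<close>
definition child_total :: "int \<Rightarrow> int \<Rightarrow> int \<Rightarrow> int \<Rightarrow> int" where
  "child_total m c X q =
    (if q = 0 then c
     else if q > 0 then (q * (X - c)) div (m - 1) - ((q - 1) * (X - c)) div (m - 1)
     else ((q + 1) * (X - c)) div (m - 1) - (q * (X - c)) div (m - 1))"

lemma div_increment_bounds:
  fixes a D n lo hi :: int
  assumes "n > 0" "lo * n \<le> D" "D \<le> hi * n"
  shows "lo \<le> (a + D) div n - a div n" "(a + D) div n - a div n \<le> hi"
proof -
  have "(a + lo * n) div n \<le> (a + D) div n" "(a + D) div n \<le> (a + hi * n) div n"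
    using assms by (intro zdiv_mono1; linarith)+
  moreover have "(a + lo * n) div n = lo + a div n" "(a + hi * n) div n = hi + a div n"
    using assms(1) by simp_all
  ultimately show "lo \<le> (a + D) div n - a div n" "(a + D) div n - a div n \<le> hi"
    by linarith+
qed

lemma child_total_bounds:
  assumes "m > 1" "q \<noteq> 0" "lo * (m - 1) \<le> X - c" "X - c \<le> hi * (m - 1)"
  shows "lo \<le> child_total m c X q" "child_total m c X q \<le> hi"
proof -
  note b = div_increment_bounds[of "m - 1" lo "X - c" hi]
  have p: "(q - 1) * (X - c) + (X - c) = q * (X - c)"
    and n: "q * (X - c) + (X - c) = (q + 1) * (X - c)"
    by (simp_all add: algebra_simps)
  show "lo \<le> child_total m c X q" "child_total m c X q \<le> hi"
    using b[of "(q - 1) * (X - c)"] b[of "q * (X - c)"] assms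
    unfolding p n by (auto simp: child_total_def)
qed

lemma sum_child_total:
  assumes "r > 0"
  shows "(\<Sum>q = -r..r. child_total (2 * r + 1) c X q) = X"
proof -
  define D where "D = X - c"
  define P where "P q = (q * D) div (2 * r)" for q
  have pos: "(\<Sum>q = 1..n. child_total (2 * r + 1) c X q) = P n" if "n \<ge> 0" for n
    using that
  proof (induction n rule: int_ge_induct)
    case base
    then show ?case by (simp add: P_def)
  next
    case (step n)
    have "{1..n + 1} = insert (n + 1) {1..n}" using step by auto
    then show ?case using step by (simp add: child_total_def P_def D_def)
  qed
  have neg: "(\<Sum>q = -n..-1. child_total (2 * r + 1) c X q) = - P (- n)" if "n \<ge> 0" for n
    using that
  proof (induction n rule: int_ge_induct)
    case base
    then show ?case by (simp add: P_def)
  next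
    case (step n)
    have "{- (n + 1)..-1} = insert (- (n + 1)) {-n..-1}" using step by auto
    moreover have "child_total (2 * r + 1) c X (- (n + 1)) = P (- n) - P (- (n + 1))"
      using step by (simp add: child_total_def P_def D_def algebra_simps)
    ultimately show ?case using step by simp
  qed
  have "{-r..r} = insert 0 ({-r..-1} \<union> {1..r})" using assms by auto
  then have "(\<Sum>q = -r..r. child_total (2 * r + 1) c X q)
      = child_total (2 * r + 1) c X 0 + ((\<Sum>q = -r..-1. child_total (2 * r + 1) c X q)
        + (\<Sum>q = 1..r. child_total (2 * r + 1) c X q))"
    by (simp add: sum.union_disjoint)
  also have "\<dots> = c + (P r - P (- r))"
    using pos[of r] neg[of r] assms by (simp add: child_total_def)
  also have "P r - P (- r) = D"
  proof -
    have "P r = D div 2" "P (- r) = (- D) div 2"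
      using assms unfolding P_def
      by (simp_all add: mult.commute[of 2] div_mult_mult1
          flip: mult_minus_right)
    then show ?thesis by presburger
  qed
  finally show ?thesis by (simp add: D_def)
qed

text \<open>
  The total of the \<open>j\<close>-th block of level \<open>K\<close> is the share which its parent, a block of level
  \<open>K + 1\<close>, assigns to it. The recursion climbs through the levels while the absolute value of
  the index decreases to \<open>0\<close>. Blocks of level \<open>0\<close> are single sites, so the sequence itself is
  \<open>block_total \<sigma> 0\<close>.
\<close>
function block_total :: "(nat \<Rightarrow> int) \<Rightarrow> nat \<Rightarrow> int \<Rightarrow> int" where
  "block_total \<sigma> K j =
    (if j = 0 then \<sigma> K
     else child_total (3 ^ Suc K) (\<sigma> K) (block_total \<sigma> (Suc K) (block_index (3 ^ Suc K) j))
            (j - 3 ^ Suc K * block_index (3 ^ Suc K) j))"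
  by auto
termination
  by (relation "Wellfounded.measure (\<lambda>(\<sigma>, K, j). nat \<bar>j\<bar>)")
    (use abs_block_index_less in \<open>auto simp del: power_Suc\<close>)

declare block_total.simps [simp del]

lemma block_total_0 [simp]: "block_total \<sigma> K 0 = \<sigma> K"
  by (simp add: block_total.simps)

lemma block_total_child:
  assumes "2 * \<bar>q\<bar> < 3 ^ Suc K"
  shows "block_total \<sigma> K (3 ^ Suc K * i + q) = child_total (3 ^ Suc K) (\<sigma> K) (block_total \<sigma> (Suc K) i) q"
proof (cases "3 ^ Suc K * i + q = 0")
  case True
  have "i = block_index (3 ^ Suc K) (3 ^ Suc K * i + q)" using block_index_eqI[OF assms] by simp
  also have "\<dots> = 0" unfolding True using block_index_eqI[of 0 "3 ^ Suc K" 0] by simp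
  finally have "i = 0" .
  then have "q = 0" using True by simp
  then show ?thesis using \<open>i = 0\<close> by (simp add: child_total_def)
next
  case False
  then show ?thesis
    by (subst block_total.simps) (simp add: block_index_eqI[OF assms] del: power_Suc)
qed

lemma block_total_central: "block_total \<sigma> K (3 ^ Suc K * i) = \<sigma> K"
  using block_total_child[of 0 K \<sigma> i] by (simp add: child_total_def)

lemma block_decompose:
  fixes j :: int
  obtains i q where "j = 3 ^ Suc K * i + q" "2 * \<bar>q\<bar> < 3 ^ Suc K"
  using that[of "block_index (3 ^ Suc K) j" "j - 3 ^ Suc K * block_index (3 ^ Suc K) j"]
    block_index_remainder[of "3 ^ Suc K" j] by simp

text \<open>
  The averages of all blocks have to stay in \<open>[1, 4]\<close>, although children deviate from their
  parents. It suffices that central averages lie in \<open>[2, 3]\<close> and that the total of a block of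
  level \<open>K\<close> is allowed to exceed the range \<open>[2 block_len K, 3 block_len K]\<close> by an integral margin which
  has relative size \<open>3 ^ (-K)\<close>.
\<close>
definition slack :: "nat \<Rightarrow> int" where
  "slack K = (case K of 0 \<Rightarrow> 1 | Suc J \<Rightarrow> block_len J)"

lemma slack_step: "2 * block_len K \<le> (3 ^ Suc K - 1) * slack K"
proof (cases K)
  case 0
  then show ?thesis by (simp add: slack_def)
next
  case (Suc J)
  have l: "block_len K = 3 ^ K * block_len J" by (simp add: Suc block_len.simps)
  have "2 * 3 ^ K * block_len J \<le> (3 ^ Suc K - 1) * block_len J"
    using block_len_pos[of J] by (intro mult_right_mono) auto
  then show ?thesis by (simp add: Suc slack_def l[unfolded Suc])
qed

lemma slack_le: "slack K \<le> block_len K"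
proof (cases K)
  case (Suc J)
  have "1 * block_len J \<le> 3 ^ Suc J * block_len J"
    using block_len_pos[of J] by (intro mult_right_mono one_le_power) auto
  then show ?thesis by (simp add: Suc slack_def block_len.simps del: power_Suc)
qed (simp add: slack_def)

lemma block_total_bounds:
  assumes "\<And>K. 2 * block_len K \<le> \<sigma> K" "\<And>K. \<sigma> K \<le> 3 * block_len K"
  shows "2 * block_len K - slack K \<le> block_total \<sigma> K j \<and> block_total \<sigma> K j \<le> 3 * block_len K + slack K"
proof (induction "nat \<bar>j\<bar>" arbitrary: K j rule: less_induct)
  case less
  have s0: "slack K \<ge> 0" using block_len_pos by (auto simp: slack_def split: nat.split intro: less_imp_le)
  obtain i q where j: "j = 3 ^ Suc K * i + q" "2 * \<bar>q\<bar> < 3 ^ Suc K"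
    by (rule block_decompose)
  show ?case
  proof (cases "q = 0")
    case True
    then show ?thesis using assms[of K] s0 block_total_central[of \<sigma> K i] j by (simp del: power_Suc)
  next
    case False
    have i: "i = block_index (3 ^ Suc K) j" using block_index_eqI[OF j(2)] j(1) by simp
    have "j \<noteq> 0"
    proof
      assume "j = 0"
      then have "i = 0" using i block_index_eqI[of 0 "3 ^ Suc K" 0] by simp
      with False j(1) \<open>j = 0\<close> show False by simp
    qed
    then have "\<bar>i\<bar> < \<bar>j\<bar>" unfolding i by (intro abs_block_index_less) (auto simp del: power_Suc)
    then have IH: "2 * block_len (Suc K) - slack (Suc K) \<le> block_total \<sigma> (Suc K) i"
      "block_total \<sigma> (Suc K) i \<le> 3 * block_len (Suc K) + slack (Suc K)"
      using less[of i "Suc K"] by auto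
    define m where "m = (3::int) ^ Suc K"
    have m: "m > 1" by (simp add: m_def del: power_Suc)
    have l: "block_len (Suc K) = m * block_len K" by (simp add: m_def block_len.simps)
    have sl: "slack (Suc K) = block_len K" by (simp add: slack_def)
    note st = slack_step[of K, folded m_def]
    have "(2 * block_len K - slack K) * (m - 1) \<le> block_total \<sigma> (Suc K) i - \<sigma> K"
      "block_total \<sigma> (Suc K) i - \<sigma> K \<le> (3 * block_len K + slack K) * (m - 1)"
      using IH st assms[of K] unfolding l sl by (auto simp: algebra_simps)
    then show ?thesis
      using child_total_bounds[of m q "2 * block_len K - slack K" "block_total \<sigma> (Suc K) i" "\<sigma> K" "3 * block_len K + slack K"]
        m False block_total_child[OF j(2), of \<sigma> i] j(1) by (simp add: m_def del: power_Suc)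
  qed
qed

text \<open>
  A subblock away from the centre gets its share \<open>(X - \<sigma> K) / (m - 1)\<close> up to an error of \<open>1\<close>.
  After division by \<open>block_len K\<close> the rounding contributes \<open>1 / block_len K\<close>, and the compensation for the
  central subblock at most \<open>2 / (m - 1)\<close>.
\<close>
lemma block_total_close:
  assumes "\<And>K. 2 * block_len K \<le> \<sigma> K" "\<And>K. \<sigma> K \<le> 3 * block_len K"
    and q: "q \<noteq> 0" "2 * \<bar>q\<bar> < 3 ^ Suc K"
  shows "\<bar>block_total \<sigma> K (3 ^ Suc K * i + q) / block_len K - block_total \<sigma> (Suc K) i / block_len (Suc K)\<bar> \<le> 2 / 3 ^ K"
proof -
  define m where "m = (3::int) ^ Suc K"
  define X where "X = block_total \<sigma> (Suc K) i"
  define c where "c = child_total m (\<sigma> K) X q"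
  define l where "l = block_len K"
  have m: "m \<ge> 3" by (simp add: m_def)
  have l: "l > 0" by (simp add: l_def block_len_pos)
  have L: "block_len (Suc K) = m * l" by (simp add: m_def l_def block_len.simps)
  define z where "z = (X - \<sigma> K) div (m - 1)"
  have zz: "(X - \<sigma> K) = z * (m - 1) + (X - \<sigma> K) mod (m - 1)"
    unfolding z_def by (rule div_mult_mod_eq[symmetric])
  have "0 \<le> (X - \<sigma> K) mod (m - 1)" "(X - \<sigma> K) mod (m - 1) < m - 1"
    using m by auto
  then have z: "z * (m - 1) \<le> X - \<sigma> K" "X - \<sigma> K \<le> (z + 1) * (m - 1)"
    using zz by (auto simp: algebra_simps)
  then have c: "z \<le> c" "c \<le> z + 1"
    using child_total_bounds[of m q z X "\<sigma> K" "z + 1"] m q by (auto simp: c_def)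
  have X: "1 * (m * l) \<le> X" "X \<le> 4 * (m * l)"
    using block_total_bounds[of \<sigma> "Suc K" i] slack_le[of "Suc K"] assms(1,2)
    by (auto simp: X_def L)
  have s: "2 * l \<le> \<sigma> K" "\<sigma> K \<le> 3 * l" using assms(1,2) by (auto simp: l_def)
  have "m * ((m - 1) * c) - (m - 1) * X \<le> m * (X - \<sigma> K + (m - 1)) - (m - 1) * X"
    "m * ((m - 1) * c) - (m - 1) * X \<ge> m * (X - \<sigma> K - (m - 1)) - (m - 1) * X"
  proof -
    have "(m - 1) * c \<le> (m - 1) * (z + 1)" "(m - 1) * z \<le> (m - 1) * c"
      using c m by (auto intro!: mult_left_mono)
    then have "(m - 1) * c \<le> X - \<sigma> K + (m - 1)" "X - \<sigma> K - (m - 1) \<le> (m - 1) * c"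
      using z by (auto simp: algebra_simps)
    then show "m * ((m - 1) * c) - (m - 1) * X \<le> m * (X - \<sigma> K + (m - 1)) - (m - 1) * X"
      "m * ((m - 1) * c) - (m - 1) * X \<ge> m * (X - \<sigma> K - (m - 1)) - (m - 1) * X"
      using m by auto
  qed
  moreover have "m * (2 * l) \<le> m * \<sigma> K" "m * \<sigma> K \<le> m * (3 * l)"
    using s m by (auto intro!: mult_left_mono)
  ultimately have "\<bar>(m - 1) * (m * c - X)\<bar> \<le> m * (m - 1) + 2 * (m * l)"
    using X by (auto simp: algebra_simps)
  then have b: "(m - 1) * \<bar>m * c - X\<bar> \<le> m * (m - 1) + 2 * (m * l)"
    using m by (simp add: abs_mult)
  have rb: "real_of_int (m - 1) * \<bar>m * c - X\<bar> \<le> m * (m - 1) + 2 * (m * l)"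
    using b by (metis of_int_le_iff of_int_mult of_int_abs of_int_add of_int_diff of_int_1 of_int_numeral)
  have rm: "real_of_int m = 3 * 3 ^ K" by (simp add: m_def)
  have rl: "3 ^ K \<le> real_of_int l"
    using block_len_ge[of K] by (metis l_def of_int_le_iff of_int_numeral of_int_power)
  have p: "(3::real) ^ K \<ge> 1" by simp
  have "\<bar>c / l - X / (m * l)\<bar> = \<bar>m * c - X\<bar> / (m * l)"
    using m l by (simp add: field_simps abs_divide flip: abs_mult)
  also have "\<dots> \<le> (m * (m - 1) + 2 * (m * l)) / ((m - 1) * (m * l))"
  proof -
    have "\<bar>m * c - X\<bar> / (m * l) = (real_of_int (m - 1) * \<bar>m * c - X\<bar>) / ((m - 1) * (m * l))"
      using m by simp
    also have "\<dots> \<le> (m * (m - 1) + 2 * (m * l)) / ((m - 1) * (m * l))"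
      using rb m l by (intro divide_right_mono) auto
    finally show ?thesis .
  qed
  also have "\<dots> = 1 / l + 2 / (m - 1)"
    using m l by (simp add: field_simps)
  also have "\<dots> \<le> 1 / 3 ^ K + 1 / 3 ^ K"
  proof (intro add_mono)
    show "1 / real_of_int l \<le> 1 / 3 ^ K"
      using rl p by (intro frac_le) auto
    show "2 / real_of_int (m - 1) \<le> 1 / 3 ^ K"
      unfolding of_int_diff of_int_1 rm using p by (simp add: divide_simps)
  qed
  finally have "\<bar>c / l - X / (m * l)\<bar> \<le> 2 / 3 ^ K" by simp
  moreover have "block_total \<sigma> K (3 ^ Suc K * i + q) = c"
    using block_total_child[OF q(2), of \<sigma> i] by (simp add: c_def m_def X_def)
  ultimately show ?thesis by (simp add: L l_def X_def)
qed

text \<open>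
  The contents of a block are a function of its level and its total alone. Since all central
  blocks of level \<open>K\<close> have the total \<open>\<sigma> K\<close>, they are copies of each other.
\<close>
lemma block_total_recurrence:
  assumes "block_total \<sigma> K a = block_total \<sigma> K b" "2 * \<bar>t\<bar> < block_len K"
  shows "block_total \<sigma> 0 (block_len K * a + t) = block_total \<sigma> 0 (block_len K * b + t)"
  using assms
proof (induction K arbitrary: a b t)
  case (0 a b t)
  then have "t = 0" by simp
  then show ?case using 0 by simp
next
  case (Suc K)
  define m where "m = (3::int) ^ Suc K"
  have odd_m: "odd m" by (simp add: m_def)
  define q where "q = block_index (block_len K) t"
  define \<rho> where "\<rho> = t - block_len K * q"
  have t: "t = block_len K * q + \<rho>" by (simp add: \<rho>_def)
  have \<rho>: "2 * \<bar>\<rho>\<bar> < block_len K"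
    using block_index_remainder[of "block_len K" t, OF odd_block_len block_len_pos] by (simp add: \<rho>_def q_def)
  have "2 * \<bar>q\<bar> < m"
  proof (rule ccontr)
    assume "\<not> 2 * \<bar>q\<bar> < m"
    then have "m + 1 \<le> 2 * \<bar>q\<bar>"
      using odd_m by presburger
    then have "block_len K * (m + 1) \<le> block_len K * (2 * \<bar>q\<bar>)"
      using block_len_pos[of K] by (intro mult_left_mono) auto
    moreover have "block_len K * \<bar>q\<bar> \<le> \<bar>t\<bar> + \<bar>\<rho>\<bar>"
      using t block_len_pos[of K] abs_mult[of "block_len K" q] by linarith
    moreover have "block_len (Suc K) = block_len K * m" by (simp add: block_len.simps m_def)
    ultimately show False using Suc.prems(2) \<rho> by (simp add: algebra_simps)
  qed
  then have "block_total \<sigma> K (m * a + q) = block_total \<sigma> K (m * b + q)"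
    using block_total_child[of q K \<sigma>] Suc.prems(1) by (simp add: m_def)
  from Suc.IH[OF this \<rho>] show ?case
    by (simp add: t block_len.simps m_def algebra_simps)
qed

section \<open>Averages over windows of a block hierarchy\<close>

text \<open>
  The value \<open>a K j\<close> stands for the average of the sequence \<open>a 0\<close> over the \<open>j\<close>-th block of
  level \<open>K\<close>. The arguments about windows are independent of how such averages are produced.
\<close>
locale block_hierarchy =
  fixes a :: "nat \<Rightarrow> int \<Rightarrow> 'a::real_normed_vector" and B C :: real
  assumes bound: "\<And>K j. norm (a K j) \<le> B"
    and central: "\<And>K i. a K (3 ^ Suc K * i) = a K 0"
    and close: "\<And>K i q. q \<noteq> 0 \<Longrightarrow> 2 * \<bar>q\<bar> < 3 ^ Suc K \<Longrightarrow>
      norm (a K (3 ^ Suc K * i + q) - a (Suc K) i) \<le> C / 3 ^ K"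
    and total: "\<And>K i r. 3 ^ Suc K = 2 * r + 1 \<Longrightarrow> r > 0 \<Longrightarrow>
      (\<Sum>q = -r..r. a K (3 ^ Suc K * i + q)) = 3 ^ Suc K *\<^sub>R a (Suc K) i"
begin

lemma B_nonneg: "0 \<le> B"
  using norm_ge_zero bound by (rule order_trans)

lemma C_nonneg: "0 \<le> C"
proof -
  have "0 \<le> C / 3 ^ 0"
    using norm_ge_zero close[of 1 0 0] by (rule order_trans) auto
  then show ?thesis by simp
qed

lemma block_sum: "sum (a 0) {block_start K j..<block_start K (j + 1)} = block_len K *\<^sub>R a K j"
proof (induction K arbitrary: j)
  case 0
  have "{block_start 0 j..<block_start 0 (j + 1)} = {j}" by (auto simp: block_start_def block_half_def)
  then show ?case by simp
next
  case (Suc K)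
  obtain r where r: "r > 0" "(3::int) ^ Suc K = 2 * r + 1" using level_odd by blast
  define m where "m = (3::int) ^ Suc K"
  have rm: "real_of_int m = 3 ^ Suc K" by (simp add: m_def)
  have "block_start (Suc K) (j + 1) = block_start K (m * j + r + 1)"
    using block_start_level[OF r(2), of "j + 1"] r(2) by (simp add: m_def algebra_simps)
  then have "sum (a 0) {block_start (Suc K) j..<block_start (Suc K) (j + 1)}
      = (\<Sum>k = m * j - r..<m * j + r + 1. sum (a 0) {block_start K k..<block_start K (k + 1)})"
    using block_start_level[OF r(2), of j] r
    by (simp only: m_def) (rule sum_over_blocks, simp)
  also have "\<dots> = block_len K *\<^sub>R (\<Sum>k = m * j - r..<m * j + r + 1. a K k)"
    by (simp add: Suc scaleR_sum_right)
  also have "(\<Sum>k = m * j - r..<m * j + r + 1. a K k) = (\<Sum>q = -r..r. a K (m * j + q))"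
    by (rule sum.reindex_bij_witness[of _ "\<lambda>q. m * j + q" "\<lambda>k. k - m * j"]) auto
  also have "\<dots> = real_of_int m *\<^sub>R a (Suc K) j"
    using total[OF r(2) r(1), of j] unfolding rm by (simp only: m_def)
  finally show ?case by (simp add: block_len.simps m_def mult.commute)
qed

text \<open>
  Replacing the sequence by its averages over the blocks of level \<open>K\<close> changes nothing on
  entire blocks, so only the two incomplete blocks at the ends of the window contribute.
\<close>
lemma level_average_error:
  assumes "u \<le> v"
  shows "norm (\<Sum>t = u..<v. a 0 t - a K (block_index (block_len K) t)) \<le> 4 * B * block_len K"
proof -
  define d where "d t = a 0 t - a K (block_index (block_len K) t)" for t
  define i where "i = block_index (block_len K) u"
  define j where "j = block_index (block_len K) v"
  have ij: "i \<le> j" using assms block_len_pos by (simp add: i_def j_def block_index_mono)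
  have block: "sum d {block_start K k..<block_start K (k + 1)} = 0" for k
  proof -
    have "(\<Sum>t = block_start K k..<block_start K (k + 1). a K (block_index (block_len K) t))
        = (\<Sum>t = block_start K k..<block_start K (k + 1). a K k)"
      by (intro sum.cong) (auto simp: block_index_eq_iff[THEN iffD2])
    also have "\<dots> = block_len K *\<^sub>R a K k"
      using block_len_pos[of K] by (simp add: block_start_Suc_index scaleR_conv_of_real sum_constant_scaleR)
    finally show ?thesis by (simp add: d_def sum_subtractf block_sum)
  qed
  have le: "block_start K i \<le> u" "u \<le> block_start K i + block_len K" "block_start K j \<le> v" "v \<le> block_start K j + block_len K"
    using block_index_bounds[of K u] block_index_bounds[of K v]
    by (auto simp: i_def j_def block_start_Suc_index)
  have d: "norm (d t) \<le> 2 * B" for t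
    unfolding d_def using norm_triangle_ineq4[of "a 0 t" "a K (block_index (block_len K) t)"]
      bound[of 0 t] bound[of K "block_index (block_len K) t"] by linarith
  have "sum d {block_start K i..<u} + sum d {u..<v} = sum d {block_start K i..<block_start K j} + sum d {block_start K j..<v}"
    using le ij assms block_start_mono[OF ij, of K] by (simp flip: sum_int_split)
  also have "sum d {block_start K i..<block_start K j} = 0"
    by (simp add: sum_over_blocks[OF ij] block)
  finally have "sum d {u..<v} = sum d {block_start K j..<v} - sum d {block_start K i..<u}"
    by (simp add: algebra_simps)
  then have "norm (sum d {u..<v}) \<le> norm (sum d {block_start K j..<v}) + norm (sum d {block_start K i..<u})"
    by (simp add: norm_triangle_ineq4)
  also have "\<dots> \<le> real_of_int (block_len K) * (2 * B) + real_of_int (block_len K) * (2 * B)"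
  proof (intro add_mono)
    have "norm (sum d {block_start K j..<v}) \<le> real_of_int (v - block_start K j) * (2 * B)"
      using le d by (intro norm_sum_int_le) auto
    also have "\<dots> \<le> real_of_int (block_len K) * (2 * B)"
      using le B_nonneg by (intro mult_right_mono) auto
    finally show "norm (sum d {block_start K j..<v}) \<le> real_of_int (block_len K) * (2 * B)" .
    have "norm (sum d {block_start K i..<u}) \<le> real_of_int (u - block_start K i) * (2 * B)"
      using le d by (intro norm_sum_int_le) auto
    also have "\<dots> \<le> real_of_int (block_len K) * (2 * B)"
      using le B_nonneg by (intro mult_right_mono) auto
    finally show "norm (sum d {block_start K i..<u}) \<le> real_of_int (block_len K) * (2 * B)" .
  qed
  finally show ?thesis by (simp add: d_def)
qed

lemma card_block: "card {block_start K j..<block_start K (j + 1)} = nat (block_len K)"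
  by (simp add: block_start_Suc_index)

lemma block_index_block_index:
  "block_index (block_len (Suc K)) t = block_index (3 ^ Suc K) (block_index (block_len K) t)"
proof -
  obtain r where r: "r > 0" "(3::int) ^ Suc K = 2 * r + 1" using level_odd by blast
  define m where "m = (3::int) ^ Suc K"
  define j where "j = block_index (block_len K) t"
  define i where "i = block_index m j"
  have "2 * \<bar>j - m * i\<bar> < m"
    unfolding i_def using r by (intro block_index_remainder) (auto simp: m_def)
  then have "m * i - r \<le> j" "j + 1 \<le> m * i + r + 1"
    using r by (auto simp: m_def)
  then have "block_start K (m * i - r) \<le> t" "t < block_start K (m * i + r + 1)"
    using block_index_bounds[of K t] block_start_mono[of _ _ K] unfolding j_def[symmetric]
    by (meson order_trans less_le_trans)+
  moreover have "m * i + r + 1 = m * (i + 1) - r" using r by (simp add: m_def algebra_simps)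
  ultimately have "block_start (Suc K) i \<le> t" "t < block_start (Suc K) (i + 1)"
    unfolding block_start_level[OF r(2)] by (simp_all only: m_def)
  then have "block_index (block_len (Suc K)) t = i" by (simp add: block_index_eq_iff)
  then show ?thesis by (simp only: i_def j_def m_def)
qed

lemma central_sites:
  fixes u v :: int
  assumes "u < v"
  shows "real (card {t \<in> {u..<v}. 3 ^ Suc K * block_index (block_len (Suc K)) t = block_index (block_len K) t})
    \<le> block_len K * ((v - u) / block_len (Suc K) + 2)"
proof -
  define m where "m = (3::int) ^ Suc K"
  define i where "i = block_index (block_len (Suc K)) u"
  define j where "j = block_index (block_len (Suc K)) v"
  have ij: "i \<le> j" using assms block_len_pos by (simp add: i_def j_def block_index_mono)
  have "card {t \<in> {u..<v}. m * block_index (block_len (Suc K)) t = block_index (block_len K) t}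
      \<le> card (\<Union>k\<in>{i..j}. {block_start K (m * k)..<block_start K (m * k + 1)})"
  proof (intro card_mono)
    show "{t \<in> {u..<v}. m * block_index (block_len (Suc K)) t = block_index (block_len K) t}
      \<subseteq> (\<Union>k\<in>{i..j}. {block_start K (m * k)..<block_start K (m * k + 1)})"
    proof
      fix t assume t: "t \<in> {t \<in> {u..<v}. m * block_index (block_len (Suc K)) t = block_index (block_len K) t}"
      then have "block_index (block_len (Suc K)) t \<in> {i..j}"
        using block_len_pos by (auto simp: i_def j_def block_index_mono)
      moreover have "t \<in> {block_start K (m * block_index (block_len (Suc K)) t)..<block_start K (m * block_index (block_len (Suc K)) t + 1)}"
        using t block_index_bounds[of K t] by auto
      ultimately show "t \<in> (\<Union>k\<in>{i..j}. {block_start K (m * k)..<block_start K (m * k + 1)})" by blast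
    qed
  qed auto
  also have "\<dots> \<le> (\<Sum>k = i..j. card {block_start K (m * k)..<block_start K (m * k + 1)})"
    by (rule card_UN_le) auto
  also have "\<dots> = nat (j - i + 1) * nat (block_len K)"
    by (simp only: card_block) simp
  finally have "card {t \<in> {u..<v}. m * block_index (block_len (Suc K)) t = block_index (block_len K) t} \<le> nat ((j - i + 1) * block_len K)"
    using ij block_len_pos[of K] by (simp add: nat_mult_distrib)
  then have "real (card {t \<in> {u..<v}. m * block_index (block_len (Suc K)) t = block_index (block_len K) t})
      \<le> real (nat ((j - i + 1) * block_len K))"
    by (rule of_nat_mono)
  also have "\<dots> = real_of_int (j - i + 1) * block_len K"
    using ij block_len_pos[of K] by simp
  also have "real_of_int (j - i + 1) \<le> (v - u) / block_len (Suc K) + 2"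
  proof -
    have "real_of_int (block_len (Suc K) * (j - i)) \<le> real_of_int (v - u + block_len (Suc K))"
      using block_index_diff_bound[of "Suc K" v u] unfolding i_def j_def of_int_le_iff by linarith
    then show ?thesis using block_len_pos[of "Suc K"] by (simp add: field_simps)
  qed
  finally show ?thesis using block_len_pos[of K] by (simp add: m_def mult.commute mult_left_mono)
qed

text \<open>
  Passing from the averages of level \<open>K\<close> to those of level \<open>K + 1\<close> costs little away from the
  central subblocks, and the central ones occupy few sites: one block of level \<open>K\<close> in each
  block of level \<open>K + 1\<close> that the window meets.
\<close>
lemma level_step_error:
  assumes "u < v"
  shows "norm (\<Sum>t = u..<v. a K (block_index (block_len K) t) - a (Suc K) (block_index (block_len (Suc K)) t))
    \<le> (v - u) * (C / 3 ^ K) + 2 * B * (block_len K * ((v - u) / block_len (Suc K) + 2))"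
proof -
  define d where "d t = a K (block_index (block_len K) t) - a (Suc K) (block_index (block_len (Suc K)) t)" for t
  define Z where "Z = {t \<in> {u..<v}. 3 ^ Suc K * block_index (block_len (Suc K)) t = block_index (block_len K) t}"
  have d: "norm (d t) \<le> 2 * B" for t
    unfolding d_def using norm_triangle_ineq4[of "a K (block_index (block_len K) t)" "a (Suc K) (block_index (block_len (Suc K)) t)"]
      bound[of K "block_index (block_len K) t"] bound[of "Suc K" "block_index (block_len (Suc K)) t"] by linarith
  have d': "norm (d t) \<le> C / 3 ^ K" if "t \<in> {u..<v} - Z" for t
  proof -
    define j where "j = block_index (block_len K) t"
    define i where "i = block_index (3 ^ Suc K) j"
    have i: "i = block_index (block_len (Suc K)) t" by (simp add: i_def j_def block_index_block_index)
    have "j - 3 ^ Suc K * i \<noteq> 0" using that by (auto simp: Z_def i j_def)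
    moreover have "2 * \<bar>j - 3 ^ Suc K * i\<bar> < 3 ^ Suc K"
      unfolding i_def by (intro block_index_remainder) auto
    ultimately show ?thesis
      using close[of "j - 3 ^ Suc K * i" K i] by (simp add: d_def i j_def del: power_Suc)
  qed
  have "norm (sum d {u..<v}) \<le> norm (sum d ({u..<v} - Z)) + norm (sum d Z)"
    by (subst sum.subset_diff[of Z]) (auto simp: Z_def norm_triangle_ineq)
  also have "norm (sum d ({u..<v} - Z)) \<le> card ({u..<v} - Z) * (C / 3 ^ K)"
    using d' by (rule sum_norm_bound)
  also have "\<dots> \<le> (v - u) * (C / 3 ^ K)"
  proof (rule mult_right_mono)
    have "card ({u..<v} - Z) \<le> card {u..<v}" by (rule card_mono) auto
    then have "real (card ({u..<v} - Z)) \<le> real (card {u..<v})" by (rule of_nat_mono)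
    then show "real (card ({u..<v} - Z)) \<le> real_of_int (v - u)" using assms by simp
  qed (use C_nonneg in auto)
  also have "norm (sum d Z) \<le> card Z * (2 * B)"
    using d by (rule sum_norm_bound)
  also have "\<dots> \<le> block_len K * ((v - u) / block_len (Suc K) + 2) * (2 * B)"
    using central_sites[OF assms, of K] B_nonneg unfolding Z_def
    by (intro mult_right_mono) auto
  finally show ?thesis by (simp add: d_def mult_ac)
qed

text \<open>
  Following the ancestors of a block, one inherits the average up to a geometric series of
  errors until one meets a central block.
\<close>
lemma near_central_value:
  "\<exists>K'\<ge>K. norm (a K j - a K' 0) \<le> 3 / 2 * (C / 3 ^ K)"
proof (induction "nat \<bar>j\<bar>" arbitrary: K j rule: less_induct)
  case less
  obtain i q where j: "j = 3 ^ Suc K * i + q" "2 * \<bar>q\<bar> < 3 ^ Suc K"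
    by (rule block_decompose)
  show ?case
  proof (cases "q = 0")
    case True
    then show ?thesis using central[of K i] j C_nonneg by (intro exI[of _ K]) simp
  next
    case False
    have i: "i = block_index (3 ^ Suc K) j" using block_index_eqI[OF j(2)] j(1) by simp
    have "j \<noteq> 0"
    proof
      assume "j = 0"
      then have "i = 0" using i block_index_eqI[of 0 "3 ^ Suc K" 0] by simp
      with False j(1) \<open>j = 0\<close> show False by simp
    qed
    then have "\<bar>i\<bar> < \<bar>j\<bar>" unfolding i by (intro abs_block_index_less) (auto simp del: power_Suc)
    then obtain K' where K': "K' \<ge> Suc K" "norm (a (Suc K) i - a K' 0) \<le> 3 / 2 * (C / 3 ^ Suc K)"
      using less[of i "Suc K"] \<open>j \<noteq> 0\<close> by (auto simp del: power_Suc)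
    have "norm (a K j - a K' 0) \<le> norm (a K j - a (Suc K) i) + norm (a (Suc K) i - a K' 0)"
      using norm_triangle_ineq[of "a K j - a (Suc K) i" "a (Suc K) i - a K' 0"] by simp
    also have "\<dots> \<le> C / 3 ^ K + 3 / 2 * (C / 3 ^ Suc K)"
      using close[OF False j(2), of i] j(1) K'(2) by simp
    also have "\<dots> = 3 / 2 * (C / 3 ^ K)" by simp
    finally show ?thesis using K'(1) by (intro exI[of _ K']) auto
  qed
qed

text \<open>
  The window meets fewer blocks of level \<open>K + 1\<close> than lie between the centre and the end of a
  block of level \<open>K + 2\<close>. If it lies in one block of level \<open>K + 2\<close>, its blocks of level \<open>K +
  1\<close> have the average of that block or the central one. If it meets two of them, it is too
  short to reach a centre, so that only the averages of these two occur. This dichotomy, which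
  excludes mixtures of three values, is the reason for placing the repeated blocks at the
  centres.
\<close>
lemma two_values:
  assumes "u < v" "v - u \<le> 2 ^ Suc K * block_len (Suc K)"
  shows "\<exists>K1\<ge>K. \<exists>K2\<ge>K. \<forall>t\<in>{u..<v}.
    norm (a (Suc K) (block_index (block_len (Suc K)) t) - a K1 0) \<le> C / 3 ^ K \<or>
    norm (a (Suc K) (block_index (block_len (Suc K)) t) - a K2 0) \<le> C / 3 ^ K"
proof -
  define m where "m = (3::int) ^ Suc (Suc K)"
  obtain r where r: "r > 0" "m = 2 * r + 1" using level_odd unfolding m_def by blast
  define i0 where "i0 = block_index (block_len (Suc K)) u"
  define i1 where "i1 = block_index (block_len (Suc K)) (v - 1)"
  define P0 where "P0 = block_index m i0"
  define P1 where "P1 = block_index m i1"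
  define p0 where "p0 = m * P0"
  define p1 where "p1 = m * P1"
  have m: "m > 0" by (simp add: m_def)
  have i01: "i0 \<le> i1" using assms block_len_pos by (simp add: i0_def i1_def block_index_mono)
  have P01: "P0 \<le> P1" using i01 m by (simp add: P0_def P1_def block_index_mono)
  have "block_len (Suc K) * (i1 - i0) < (v - 1) - u + block_len (Suc K)"
    unfolding i0_def i1_def by (rule block_index_diff_bound)
  also have "\<dots> < 2 ^ Suc K * block_len (Suc K) + block_len (Suc K)" using assms by simp
  also have "\<dots> = block_len (Suc K) * (2 ^ Suc K + 1)" by (simp add: algebra_simps)
  finally have "i1 - i0 < 2 ^ Suc K + 1"
    using block_len_pos[of "Suc K"] by (simp only: mult_less_cancel_left_pos)
  moreover have "2 * (2::int) ^ Suc K < m"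
  proof -
    have "(2::int) ^ Suc K \<le> 3 ^ Suc K" by (rule power_mono) auto
    moreover have "(0::int) < 3 ^ Suc K" by simp
    moreover have "m = 3 * 3 ^ Suc K" by (simp add: m_def)
    ultimately show ?thesis by linarith
  qed
  ultimately have short: "i1 - i0 \<le> r" using r by linarith
  have "2 * \<bar>i0 - p0\<bar> < m" "2 * \<bar>i1 - p1\<bar> < m"
    unfolding p0_def p1_def P0_def P1_def using r by (intro block_index_remainder; simp)+
  then have rem: "2 * i0 < m + 2 * p0" "2 * p0 < m + 2 * i0" "2 * i1 < m + 2 * p1" "2 * p1 < m + 2 * i1"
    by presburger+
  have in_range: "i0 \<le> block_index (block_len (Suc K)) t" "block_index (block_len (Suc K)) t \<le> i1"
    "P0 \<le> block_index m (block_index (block_len (Suc K)) t)" "block_index m (block_index (block_len (Suc K)) t) \<le> P1" if "t \<in> {u..<v}" for t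
    using that block_len_pos m by (auto simp: i0_def i1_def P0_def P1_def block_index_mono)
  have noncentral: "norm (a (Suc K) i - a (Suc (Suc K)) (block_index m i)) \<le> C / 3 ^ Suc K"
    if "i \<noteq> m * block_index m i" for i
    using close[of "i - m * block_index m i" "Suc K" "block_index m i"] block_index_remainder[of m i] that r
    unfolding m_def[symmetric] by simp
  have combine: "norm (x - z) \<le> C / 3 ^ K"
    if "norm (x - y) \<le> C / 3 ^ Suc K" "norm (y - z) \<le> 3 / 2 * (C / 3 ^ Suc (Suc K))" for x y z :: 'a
  proof -
    have "norm (x - z) \<le> norm (x - y) + norm (y - z)"
      using norm_triangle_ineq[of "x - y" "y - z"] by simp
    also have "\<dots> \<le> C / 3 ^ Suc K + 3 / 2 * (C / 3 ^ Suc (Suc K))" using that by simp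
    also have "\<dots> = 1 / 2 * (C / 3 ^ K)" by (simp add: field_simps)
    also have "\<dots> \<le> 1 * (C / 3 ^ K)" using C_nonneg by (intro mult_right_mono) auto
    finally show ?thesis by simp
  qed
  obtain K0 where K0: "K0 \<ge> Suc (Suc K)"
    "norm (a (Suc (Suc K)) P0 - a K0 0) \<le> 3 / 2 * (C / 3 ^ Suc (Suc K))"
    using near_central_value by blast
  obtain K1 where K1: "K1 \<ge> Suc (Suc K)"
    "norm (a (Suc (Suc K)) P1 - a K1 0) \<le> 3 / 2 * (C / 3 ^ Suc (Suc K))"
    using near_central_value by blast
  show ?thesis
  proof (cases "P0 = P1")
    case True
    have "norm (a (Suc K) (block_index (block_len (Suc K)) t) - a (Suc K) 0) \<le> C / 3 ^ K \<or>
      norm (a (Suc K) (block_index (block_len (Suc K)) t) - a K0 0) \<le> C / 3 ^ K" if "t \<in> {u..<v}" for t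
    proof (cases "block_index (block_len (Suc K)) t = m * block_index m (block_index (block_len (Suc K)) t)")
      case True
      have "a (Suc K) (m * block_index m (block_index (block_len (Suc K)) t)) = a (Suc K) 0"
        unfolding m_def by (rule central)
      then have "a (Suc K) (block_index (block_len (Suc K)) t) = a (Suc K) 0" unfolding True[symmetric] .
      then show ?thesis using C_nonneg by simp
    next
      case False
      have "block_index m (block_index (block_len (Suc K)) t) = P0" using in_range[OF that] True by simp
      then show ?thesis using combine[OF _ K0(2)] noncentral[OF False] by auto
    qed
    then show ?thesis using K0(1) by (intro exI[of _ "Suc K"] conjI exI[of _ K0]) auto
  next
    case False
    have adj: "P1 = P0 + 1"
    proof (rule ccontr)
      assume "P1 \<noteq> P0 + 1"
      then have "P0 + 2 \<le> P1" using P01 False by simp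
      then have "m * (P0 + 2) \<le> m * P1" using m by simp
      then have "p0 + 2 * m \<le> p1" by (simp add: p0_def p1_def algebra_simps)
      then show False using rem short r by linarith
    qed
    have "norm (a (Suc K) (block_index (block_len (Suc K)) t) - a K0 0) \<le> C / 3 ^ K \<or>
      norm (a (Suc K) (block_index (block_len (Suc K)) t) - a K1 0) \<le> C / 3 ^ K" if "t \<in> {u..<v}" for t
    proof -
      define i where "i = block_index (block_len (Suc K)) t"
      have i: "i0 \<le> i" "i \<le> i1" "block_index m i = P0 \<or> block_index m i = P1"
        using in_range[OF that] adj by (auto simp: i_def)
      have "p1 = p0 + m" by (simp add: p0_def p1_def adj algebra_simps)
      then have "i \<noteq> p0" "i \<noteq> p1"
        using i(1,2) rem short r by linarith+
      then have "i \<noteq> m * block_index m i" using i(3) by (auto simp: p0_def p1_def)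
      from noncentral[OF this] show ?thesis
        using i(3) combine[OF _ K0(2)] combine[OF _ K1(2)] by (auto simp: i_def)
    qed
    then show ?thesis using K0(1) K1(1) by (intro exI[of _ K0] conjI exI[of _ K1]) auto
  qed
qed

lemma average_of_two_values:
  fixes g :: "int \<Rightarrow> 'a"
  assumes "u < v" "0 \<le> e" "\<forall>t\<in>{u..<v}. norm (g t - x) \<le> e \<or> norm (g t - y) \<le> e"
  shows "\<exists>\<theta>\<in>{0..1}. norm (sum g {u..<v} - (v - u) *\<^sub>R ((1 - \<theta>) *\<^sub>R x + \<theta> *\<^sub>R y)) \<le> (v - u) * e"
proof -
  (* the proportion of the second value is the proportion of sites that are not near the first *)
  define X where "X = {t \<in> {u..<v}. norm (g t - x) \<le> e}"
  define Y where "Y = {u..<v} - X"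
  define \<theta> where "\<theta> = card Y / real_of_int (v - u)"
  have n: "real_of_int (v - u) > 0" using assms(1) by simp
  have "X \<subseteq> {u..<v}" by (auto simp: X_def)
  then have "card X + card Y = card {u..<v}"
    unfolding Y_def by (simp add: card_Diff_subset finite_subset card_mono del: card_atLeastLessThan_int)
  then have cXY: "real (card X) + real (card Y) = v - u"
    using assms(1) by (metis card_atLeastLessThan_int of_nat_add of_nat_nat of_int_of_nat_eq diff_ge_0_iff_ge less_imp_le)
  have scaled: "(v - u) *\<^sub>R ((1 - \<theta>) *\<^sub>R x + \<theta> *\<^sub>R y) = card X *\<^sub>R x + card Y *\<^sub>R y"
  proof -
    have Y: "real_of_int (v - u) * \<theta> = card Y"
      using n by (simp add: \<theta>_def)
    then have "real_of_int (v - u) * (1 - \<theta>) = card X"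
      using cXY by (simp add: right_diff_distrib)
    note this Y
    then show ?thesis by (simp add: scaleR_add_right)
  qed
  have "sum g {u..<v} = sum g Y + sum g X"
    unfolding Y_def by (rule sum.subset_diff) (auto simp: X_def)
  then have "sum g {u..<v} - (v - u) *\<^sub>R ((1 - \<theta>) *\<^sub>R x + \<theta> *\<^sub>R y)
      = (\<Sum>t\<in>X. g t - x) + (\<Sum>t\<in>Y. g t - y)"
    unfolding scaled by (simp add: sum_subtractf sum_constant_scaleR)
  also have "norm \<dots> \<le> card X * e + card Y * e"
    using assms(3) by (intro norm_triangle_mono sum_norm_bound) (auto simp: X_def Y_def)
  also have "\<dots> = (v - u) * e" using cXY by (simp flip: distrib_right)
  finally have *: "norm (sum g {u..<v} - (v - u) *\<^sub>R ((1 - \<theta>) *\<^sub>R x + \<theta> *\<^sub>R y)) \<le> (v - u) * e" .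
  have "real (card Y) \<le> v - u" using cXY by simp
  then have "\<theta> \<in> {0..1}" using n by (simp add: \<theta>_def field_simps)
  with * show ?thesis by (intro bexI[of _ \<theta>]) auto
qed

text \<open>
  For window lengths between \<open>2 ^ K * block_len K\<close> and \<open>2 ^ (K + 1) * block_len (K + 1)\<close> all previous
  errors are small: incomplete blocks of level \<open>K\<close> are short compared with the window, and the
  window is still too short to see three values at level \<open>K + 1\<close>.
\<close>
lemma window_average:
  assumes n: "2 ^ K * block_len K \<le> n" "n \<le> 2 ^ Suc K * block_len (Suc K)"
  shows "\<exists>K1\<ge>K. \<exists>K2\<ge>K. \<exists>\<theta>\<in>{0..1}.
    norm (sum (a 0) {u..<u + n} - n *\<^sub>R ((1 - \<theta>) *\<^sub>R a K1 0 + \<theta> *\<^sub>R a K2 0))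
      \<le> n * ((10 * B + 2 * C) / 2 ^ K)"
proof -
  have "0 < 2 ^ K * block_len K" using block_len_pos by simp
  then have n0: "n > 0" using n(1) by linarith
  define g where "g J t = a J (block_index (block_len J) t)" for J t
  define W where "W = {u..<u + n}"
  obtain K1 K2 where K: "K1 \<ge> K" "K2 \<ge> K" "\<forall>t\<in>W.
    norm (g (Suc K) t - a K1 0) \<le> C / 3 ^ K \<or> norm (g (Suc K) t - a K2 0) \<le> C / 3 ^ K"
    using two_values[of u "u + n" K] n0 n(2) unfolding g_def W_def by auto
  obtain \<theta> where \<theta>: "\<theta> \<in> {0..1}"
    "norm (sum (g (Suc K)) W - n *\<^sub>R ((1 - \<theta>) *\<^sub>R a K1 0 + \<theta> *\<^sub>R a K2 0)) \<le> n * (C / 3 ^ K)"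
    using average_of_two_values[of u "u + n" "C / 3 ^ K" "g (Suc K)" "a K1 0" "a K2 0"] K(3) n0 C_nonneg
    unfolding W_def by auto
  define p where "p = (1 - \<theta>) *\<^sub>R a K1 0 + \<theta> *\<^sub>R a K2 0"
  have e1: "norm (sum (a 0) W - sum (g K) W) \<le> 4 * B * block_len K"
    using level_average_error[of u "u + n" K] n0 by (simp add: g_def W_def sum_subtractf)
  have e2: "norm (sum (g K) W - sum (g (Suc K)) W)
      \<le> n * (C / 3 ^ K) + 2 * B * (block_len K * (n / block_len (Suc K) + 2))"
    using level_step_error[of u "u + n" K] n0 by (simp add: g_def W_def sum_subtractf)
  have lK: "real_of_int (block_len K) \<le> n / 2 ^ K"
  proof -
    have "real_of_int (2 ^ K * block_len K) \<le> n" using n(1) by (simp only: of_int_le_iff)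
    then show ?thesis by (simp add: field_simps)
  qed
  have cmp: "C / 3 ^ K \<le> C / 2 ^ K"
    using C_nonneg by (intro divide_left_mono power_mono) auto
  have frac: "real_of_int (block_len K) * (n / block_len (Suc K)) \<le> n / 2 ^ K"
  proof -
    have "real_of_int (block_len K) * (n / block_len (Suc K)) = n / 3 ^ Suc K"
      using block_len_pos[of K] by (simp add: block_len.simps)
    also have "\<dots> \<le> n / 2 ^ K"
    proof (rule divide_left_mono)
      have "(2::real) ^ K \<le> 3 ^ K" by (rule power_mono) auto
      also have "\<dots> \<le> 3 ^ Suc K" by simp
      finally show "(2::real) ^ K \<le> 3 ^ Suc K" .
    qed (use n0 in auto)
    finally show ?thesis .
  qed
  have "norm (sum (a 0) W - n *\<^sub>R p) \<le> norm (sum (a 0) W - sum (g K) W)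
      + norm (sum (g K) W - sum (g (Suc K)) W) + norm (sum (g (Suc K)) W - n *\<^sub>R p)"
  proof -
    have "sum (a 0) W - n *\<^sub>R p = (sum (a 0) W - sum (g K) W)
        + (sum (g K) W - sum (g (Suc K)) W) + (sum (g (Suc K)) W - n *\<^sub>R p)" by simp
    then show ?thesis by (metis norm_triangle_ineq norm_triangle_mono order_refl)
  qed
  also have "\<dots> \<le> 4 * B * block_len K + (n * (C / 3 ^ K) + 2 * B * (block_len K * (n / block_len (Suc K) + 2))) + n * (C / 3 ^ K)"
    using e1 e2 \<theta>(2) unfolding p_def by (intro add_mono)
  also have "\<dots> = 8 * B * block_len K + 2 * (n * (C / 3 ^ K)) + 2 * B * (block_len K * (n / block_len (Suc K)))"
    by (simp add: distrib_left distrib_right)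
  also have "\<dots> \<le> 8 * B * (n / 2 ^ K) + 2 * (n * (C / 2 ^ K)) + 2 * B * (n / 2 ^ K)"
    using lK cmp frac B_nonneg n0 by (intro add_mono mult_left_mono) auto
  also have "\<dots> = n * ((10 * B + 2 * C) / 2 ^ K)"
    by (simp add: field_simps)
  finally show ?thesis using K(1,2) \<theta>(1) unfolding p_def W_def by blast
qed

text \<open>
  Inside the central block of level \<open>K + 2\<close>, the central block of level \<open>K + 1\<close> has its own
  average, while its right neighbour nearly has that of the block around it. A window moving
  from the right part of the former to the left part of the latter, in steps of blocks of
  level \<open>K\<close>, avoids the centres of both and mixes their averages in every proportion.
\<close>
lemma mixture_window:
  assumes \<theta>: "\<theta> \<in> {0..1}"
  shows "\<exists>u n. 3 ^ K \<le> n \<and>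
    norm (sum (a 0) {u..<u + n} - n *\<^sub>R ((1 - \<theta>) *\<^sub>R a (Suc K) 0 + \<theta> *\<^sub>R a (Suc (Suc K)) 0))
      \<le> n * ((2 * B + 2 * C) / 3 ^ K)"
proof -
  define m where "m = (3::int) ^ Suc K"
  obtain r where r: "r > 0" "m = 2 * r + 1" using level_odd unfolding m_def by blast
  define x where "x = a (Suc K) 0"
  define y where "y = a (Suc (Suc K)) 0"
  define d where "d = \<lfloor>\<theta> * r\<rfloor>"
  have \<theta>': "0 \<le> \<theta>" "\<theta> \<le> 1" using \<theta> by auto
  have d: "0 \<le> d" "d \<le> r"
  proof -
    show "0 \<le> d" using \<theta>' r by (simp add: d_def)
    have "\<theta> * r \<le> 1 * real_of_int r" using \<theta>' r by (intro mult_right_mono) auto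
    then show "d \<le> r" unfolding d_def by linarith
  qed
  have left: "norm (a K j - x) \<le> C / 3 ^ K" if "1 \<le> j" "j \<le> r" for j
    using close[of j K 0] that r by (simp add: x_def m_def[symmetric] del: power_Suc)
  have right: "norm (a K j - y) \<le> 2 * C / 3 ^ K" if "r < j" "j \<le> 2 * r" for j
  proof -
    have "norm (a K (m * 1 + (j - m)) - a (Suc K) 1) \<le> C / 3 ^ K"
      unfolding m_def by (rule close) (use that r in \<open>auto simp: m_def[symmetric] simp del: power_Suc\<close>)
    moreover have "norm (a (Suc K) (3 ^ Suc (Suc K) * 0 + 1) - a (Suc (Suc K)) 0) \<le> C / 3 ^ Suc K"
    proof (rule close)
      have "(1::int) \<le> 3 ^ K" by simp
      moreover have "(3::int) ^ Suc (Suc K) = 9 * 3 ^ K" by simp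
      ultimately show "2 * \<bar>1::int\<bar> < 3 ^ Suc (Suc K)" by linarith
    qed simp
    moreover have "C / 3 ^ Suc K \<le> C / 3 ^ K" using C_nonneg by (intro divide_left_mono) auto
    ultimately show ?thesis
      using norm_triangle_ineq[of "a K j - a (Suc K) 1" "a (Suc K) 1 - y"]
      by (simp add: y_def)
  qed
  define l where "l = block_len K"
  have l: "l > 0" by (simp add: l_def block_len_pos)
  define u where "u = block_start K (d + 1)"
  define n where "n = r * l"
  have un: "u + n = block_start K (d + r + 1)"
    by (simp add: u_def n_def block_start_def l_def algebra_simps)
  have n1: "3 ^ K \<le> n"
  proof -
    have "1 * l \<le> r * l" using l r by (intro mult_right_mono) auto
    then show ?thesis using block_len_ge[of K] by (simp add: n_def l_def)
  qed
  have S: "sum (a 0) {u..<u + n} = l *\<^sub>R sum (a K) {d + 1..<d + r + 1}"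
    unfolding un unfolding u_def using r
    by (subst sum_over_blocks) (auto simp: block_sum scaleR_sum_right l_def)
  have split: "sum (a K) {d + 1..<d + r + 1} = sum (a K) {d + 1..<r + 1} + sum (a K) {r + 1..<d + r + 1}"
    using d by (intro sum_int_split) auto
  have e1: "norm (sum (a K) {d + 1..<r + 1} - (r - d) *\<^sub>R x) \<le> (r - d) * (C / 3 ^ K)"
    using norm_sum_int_le[of "d + 1" "r + 1" "\<lambda>j. a K j - x" "C / 3 ^ K"] left d
    by (simp add: sum_subtractf sum_constant_scaleR)
  have e2: "norm (sum (a K) {r + 1..<d + r + 1} - d *\<^sub>R y) \<le> d * (2 * C / 3 ^ K)"
    using norm_sum_int_le[of "r + 1" "d + r + 1" "\<lambda>j. a K j - y" "2 * C / 3 ^ K"] right d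
    by (simp add: sum_subtractf sum_constant_scaleR)
  define p where "p = (1 - \<theta>) *\<^sub>R x + \<theta> *\<^sub>R y"
  have e3: "norm ((r - d) *\<^sub>R x + d *\<^sub>R y - r *\<^sub>R p) \<le> 2 * B"
  proof -
    have "(r - d) *\<^sub>R x + d *\<^sub>R y - r *\<^sub>R p = (\<theta> * r - d) *\<^sub>R (x - y)"
      by (simp add: p_def algebra_simps)
    also have "norm \<dots> = (\<theta> * r - d) * norm (x - y)"
      unfolding d_def by simp
    also have "\<dots> \<le> 1 * (B + B)"
    proof (rule mult_mono)
      show "\<theta> * r - d \<le> 1" unfolding d_def by linarith
      show "norm (x - y) \<le> B + B"
        using norm_triangle_ineq4[of x y] bound[of "Suc K" 0] bound[of "Suc (Suc K)" 0]
        unfolding x_def y_def by linarith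
    qed auto
    finally show ?thesis by simp
  qed
  have "norm (sum (a K) {d + 1..<d + r + 1} - r *\<^sub>R p)
      \<le> norm (sum (a K) {d + 1..<r + 1} - (r - d) *\<^sub>R x)
        + norm (sum (a K) {r + 1..<d + r + 1} - d *\<^sub>R y)
        + norm ((r - d) *\<^sub>R x + d *\<^sub>R y - r *\<^sub>R p)"
  proof -
    have "sum (a K) {d + 1..<d + r + 1} - r *\<^sub>R p
      = (sum (a K) {d + 1..<r + 1} - (r - d) *\<^sub>R x)
        + (sum (a K) {r + 1..<d + r + 1} - d *\<^sub>R y)
        + ((r - d) *\<^sub>R x + d *\<^sub>R y - r *\<^sub>R p)"
      unfolding split by simp
    then show ?thesis by (metis norm_triangle_ineq norm_triangle_mono order_refl)
  qed
  also have "\<dots> \<le> (r - d) * (C / 3 ^ K) + d * (2 * C / 3 ^ K) + 2 * B"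
    by (intro add_mono e1 e2 e3)
  also have "\<dots> \<le> r * (2 * C / 3 ^ K) + r * (2 * B / 3 ^ K)"
  proof (rule add_mono)
    have "(r - d) * (C / 3 ^ K) \<le> (r - d) * (2 * C / 3 ^ K)"
      using d C_nonneg by (intro mult_left_mono divide_right_mono) auto
    moreover have "r * (2 * C / 3 ^ K) = (r - d) * (2 * C / 3 ^ K) + d * (2 * C / 3 ^ K)"
      by (simp add: field_simps)
    ultimately show "(r - d) * (C / 3 ^ K) + d * (2 * C / 3 ^ K) \<le> r * (2 * C / 3 ^ K)"
      by simp
    have "(1::int) \<le> 3 ^ K" by simp
    then have "(3::int) ^ K \<le> r" using r by (simp add: m_def)
    then have "real_of_int (3 ^ K) \<le> r" by (simp only: of_int_le_iff)
    then have "2 * B * 3 ^ K \<le> 2 * B * r" using B_nonneg by (intro mult_left_mono) auto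
    then show "2 * B \<le> r * (2 * B / 3 ^ K)" by (simp add: field_simps)
  qed
  also have "\<dots> = r * ((2 * B + 2 * C) / 3 ^ K)" by (simp add: field_simps)
  finally have "l * norm (sum (a K) {d + 1..<d + r + 1} - r *\<^sub>R p) \<le> l * (r * ((2 * B + 2 * C) / 3 ^ K))"
    using l by (intro mult_left_mono) auto
  moreover have "sum (a 0) {u..<u + n} - n *\<^sub>R p = l *\<^sub>R (sum (a K) {d + 1..<d + r + 1} - r *\<^sub>R p)"
    unfolding S by (simp add: n_def scaleR_diff_right mult.commute)
  ultimately have "norm (sum (a 0) {u..<u + n} - n *\<^sub>R p) \<le> n * ((2 * B + 2 * C) / 3 ^ K)"
    using l by (simp add: n_def mult_ac)
  then show ?thesis using n1 unfolding p_def x_def y_def by blast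
qed

end
lemma norm_average_diff:
  fixes z p :: "'a::real_normed_vector"
  assumes "n > 0" "norm (z - n *\<^sub>R p) \<le> n * e"
  shows "norm (z /\<^sub>R n - p) \<le> e"
proof -
  have "z /\<^sub>R n - p = (1 / n) *\<^sub>R (z - n *\<^sub>R p)"
    using assms(1) by (simp add: scaleR_diff_right divide_inverse)
  then have "norm (z /\<^sub>R n - p) = norm (z - n *\<^sub>R p) / n" using assms(1) by simp
  then show ?thesis using assms by (simp add: divide_le_eq mult.commute)
qed

lemma norm_mix_diff:
  fixes x y x' y' :: "'a::real_normed_vector"
  assumes "\<theta> \<in> {0..1}" "norm (x - x') \<le> e" "norm (y - y') \<le> e"
  shows "norm (((1 - \<theta>) *\<^sub>R x + \<theta> *\<^sub>R y) - ((1 - \<theta>) *\<^sub>R x' + \<theta> *\<^sub>R y')) \<le> e"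
proof -
  have "((1 - \<theta>) *\<^sub>R x + \<theta> *\<^sub>R y) - ((1 - \<theta>) *\<^sub>R x' + \<theta> *\<^sub>R y')
    = (1 - \<theta>) *\<^sub>R (x - x') + \<theta> *\<^sub>R (y - y')"
    by (simp add: algebra_simps)
  also have "norm \<dots> \<le> norm ((1 - \<theta>) *\<^sub>R (x - x')) + norm (\<theta> *\<^sub>R (y - y'))"
    by (rule norm_triangle_ineq)
  also have "\<dots> = (1 - \<theta>) * norm (x - x') + \<theta> * norm (y - y')" using assms(1) by simp
  also have "\<dots> \<le> (1 - \<theta>) * e + \<theta> * e"
    using assms by (intro add_mono mult_left_mono) auto
  finally show ?thesis by (simp add: algebra_simps)
qed

lemma norm_diff_chain:
  fixes p q r w :: "'a::real_normed_vector"
  assumes "norm (p - q) < e / 3" "norm (q - r) \<le> e / 3" "norm (r - w) \<le> e / 3"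
  shows "norm (p - w) < e"
  using assms norm_triangle_ineq[of "p - q" "q - r"] norm_triangle_ineq[of "p - r" "r - w"]
  by simp

lemma geometric_small:
  fixes c b e :: real
  assumes "b > 1" "e > 0"
  shows "\<exists>N. \<forall>K\<ge>N. c / b ^ K < e"
proof -
  have "(\<lambda>K. c / b ^ K) \<longlonglongrightarrow> 0"
    by (rule LIMSEQ_divide_realpow_zero[OF assms(1)])
  from order_tendstoD(2)[OF this assms(2)] show ?thesis
    by (simp add: eventually_sequentially)
qed

context block_hierarchy
begin

lemma scale_exists:
  assumes "1 \<le> n"
  shows "\<exists>K. 2 ^ K * block_len K \<le> n \<and> n \<le> 2 ^ Suc K * block_len (Suc K)"
proof -
  have "n \<le> 2 ^ Suc K * block_len (Suc K)" if "K = nat n" for K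
  proof -
    have "1 * 2 ^ K \<le> block_len (Suc K) * 2 ^ Suc K"
      using block_len_pos[of "Suc K"] by (intro mult_mono) auto
    moreover have "n \<le> int K" using that by simp
    moreover have "int K < 2 ^ K"
      using of_nat_less_two_power[of K] by simp
    moreover have "2 ^ Suc K * block_len (Suc K) = block_len (Suc K) * 2 ^ Suc K" by simp
    ultimately show ?thesis by linarith
  qed
  then have ex: "\<exists>K. n \<le> 2 ^ Suc K * block_len (Suc K)" by blast
  define K where "K = (LEAST K. n \<le> 2 ^ Suc K * block_len (Suc K))"
  have K: "n \<le> 2 ^ Suc K * block_len (Suc K)" unfolding K_def using ex by (rule LeastI_ex)
  have "2 ^ K * block_len K \<le> n"
  proof (cases K)
    case 0
    then show ?thesis using assms by simp
  next
    case (Suc J)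
    then have "\<not> n \<le> 2 ^ Suc J * block_len (Suc J)"
      using not_less_Least[of J "\<lambda>K. n \<le> 2 ^ Suc K * block_len (Suc K)"] by (simp add: K_def)
    then show ?thesis using Suc by simp
  qed
  with K show ?thesis by blast
qed

lemma window_limits_near_mixture:
  assumes x: "\<And>K. norm (a K 0 - x K) \<le> D / 3 ^ K" "0 \<le> D"
    and \<rho>: "\<rho> \<in> window_limits (a 0)" and e: "e > 0"
  shows "\<exists>i\<ge>N. \<exists>j\<ge>N. \<exists>\<theta>\<in>{0..1}. norm (\<rho> - ((1 - \<theta>) *\<^sub>R x i + \<theta> *\<^sub>R x j)) < e"
proof -
  obtain N1 where N1: "\<And>K. K \<ge> N1 \<Longrightarrow> (10 * B + 2 * C) / 2 ^ K < e / 3"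
    using geometric_small[of 2 "e / 3" "10 * B + 2 * C"] e by auto
  obtain N2 where N2: "\<And>K. K \<ge> N2 \<Longrightarrow> D / 3 ^ K < e / 3"
    using geometric_small[of 3 "e / 3" D] e by auto
  define J where "J = max N (max N1 N2)"
  obtain n u where n: "n \<ge> nat (2 ^ Suc J * block_len (Suc J)) + 1" "n > 0"
    "norm (sum (a 0) {u..<u + int n} /\<^sub>R real n - \<rho>) < e / 3"
    using window_limitsE[OF \<rho>, of "e / 3"] e by (metis divide_pos_pos zero_less_numeral)
  obtain K where K: "2 ^ K * block_len K \<le> int n" "int n \<le> 2 ^ Suc K * block_len (Suc K)"
    using scale_exists[of "int n"] n(2) by auto
  have "J \<le> K"
  proof (rule ccontr)
    assume "\<not> J \<le> K"
    then have "Suc K \<le> Suc J" by simp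
    have mono: "mono (\<lambda>K. 2 ^ K * block_len K)"
    proof (rule incseq_SucI)
      fix K
      have "1 * block_len K \<le> 3 ^ Suc K * block_len K"
        using block_len_pos[of K] by (intro mult_right_mono one_le_power) auto
      then have "2 ^ K * block_len K \<le> 2 ^ Suc K * block_len (Suc K)"
        using block_len_pos[of K] by (intro mult_mono) (auto simp: block_len.simps)
      then show "(2::int) ^ K * block_len K \<le> 2 ^ Suc K * block_len (Suc K)" .
    qed
    have "2 ^ Suc K * block_len (Suc K) \<le> 2 ^ Suc J * block_len (Suc J)"
      using monoD[OF mono \<open>Suc K \<le> Suc J\<close>] .
    then show False using K(2) n(1) by linarith
  qed
  obtain K1 K2 \<theta> where w: "K1 \<ge> K" "K2 \<ge> K" "\<theta> \<in> {0..1}"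
    "norm (sum (a 0) {u..<u + int n} - int n *\<^sub>R ((1 - \<theta>) *\<^sub>R a K1 0 + \<theta> *\<^sub>R a K2 0))
      \<le> int n * ((10 * B + 2 * C) / 2 ^ K)"
    using window_average[OF K, of u] by blast
  have "norm (sum (a 0) {u..<u + int n} /\<^sub>R real n - ((1 - \<theta>) *\<^sub>R a K1 0 + \<theta> *\<^sub>R a K2 0)) \<le> (10 * B + 2 * C) / 2 ^ K"
    using w(4) n(2) by (intro norm_average_diff) auto
  also have "\<dots> < e / 3" using N1[of K] \<open>J \<le> K\<close> by (auto simp: J_def)
  finally have e1: "norm (sum (a 0) {u..<u + int n} /\<^sub>R real n - ((1 - \<theta>) *\<^sub>R a K1 0 + \<theta> *\<^sub>R a K2 0)) < e / 3" .
  have near: "norm (a L 0 - x L) \<le> e / 3" if "L \<ge> K" for L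
    by (rule order_trans[OF x(1) less_imp_le[OF N2]]) (use that \<open>J \<le> K\<close> in \<open>simp add: J_def\<close>)
  have e2: "norm (((1 - \<theta>) *\<^sub>R a K1 0 + \<theta> *\<^sub>R a K2 0) - ((1 - \<theta>) *\<^sub>R x K1 + \<theta> *\<^sub>R x K2)) \<le> e / 3"
    using w near by (intro norm_mix_diff) auto
  have "norm (\<rho> - ((1 - \<theta>) *\<^sub>R x K1 + \<theta> *\<^sub>R x K2)) < e"
    by (rule norm_diff_chain[OF _ less_imp_le[OF e1] e2]) (use n(3) in \<open>simp add: norm_minus_commute\<close>)
  moreover have "K1 \<ge> N" "K2 \<ge> N" using w(1,2) \<open>J \<le> K\<close> by (auto simp: J_def)
  ultimately show ?thesis using w(3) by blast
qed

lemma mixture_in_window_limits: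
  assumes x: "\<And>K. norm (a K 0 - x K) \<le> D / 3 ^ K" "0 \<le> D"
    and \<rho>: "\<And>e N. e > 0 \<Longrightarrow> \<exists>K\<ge>N. \<exists>\<theta>\<in>{0..1}. norm (\<rho> - ((1 - \<theta>) *\<^sub>R x K + \<theta> *\<^sub>R x (Suc K))) < e"
  shows "\<rho> \<in> window_limits (a 0)"
proof (rule window_limitsI)
  fix e :: real and N :: nat
  assume e: "e > 0"
  obtain N1 where N1: "\<And>K. K \<ge> N1 \<Longrightarrow> (2 * B + 2 * C) / 3 ^ K < e / 3"
    using geometric_small[of 3 "e / 3" "2 * B + 2 * C"] e by auto
  obtain N2 where N2: "\<And>K. K \<ge> N2 \<Longrightarrow> D / 3 ^ K < e / 3"
    using geometric_small[of 3 "e / 3" D] e by auto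
  obtain K' \<theta> where K': "K' \<ge> Suc (max N (max N1 N2))" "\<theta> \<in> {0..1}"
    "norm (\<rho> - ((1 - \<theta>) *\<^sub>R x K' + \<theta> *\<^sub>R x (Suc K'))) < e / 3"
    using \<rho>[of "e / 3" "Suc (max N (max N1 N2))"] e by auto
  define K where "K = K' - 1"
  have K: "K' = Suc K" "K \<ge> N" "K \<ge> N1" "K \<ge> N2" using K'(1) by (auto simp: K_def)
  obtain u n where n: "3 ^ K \<le> n"
    "norm (sum (a 0) {u..<u + n} - n *\<^sub>R ((1 - \<theta>) *\<^sub>R a (Suc K) 0 + \<theta> *\<^sub>R a (Suc (Suc K)) 0))
      \<le> n * ((2 * B + 2 * C) / 3 ^ K)"
    using mixture_window[OF K'(2), of K] by blast
  have "int K < 3 ^ K"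
  proof -
    have "int K < 2 ^ K" using of_nat_less_two_power[of K] by simp
    also have "(2::int) ^ K \<le> 3 ^ K" by (rule power_mono) auto
    finally show ?thesis .
  qed
  then have nK: "n > int K" using n(1) by linarith
  have near: "norm (a L 0 - x L) \<le> e / 3" if "L \<ge> K" for L
    by (rule order_trans[OF x(1) less_imp_le[OF N2]]) (use that K(4) in simp)
  have "norm (sum (a 0) {u..<u + n} /\<^sub>R real_of_int n - ((1 - \<theta>) *\<^sub>R a (Suc K) 0 + \<theta> *\<^sub>R a (Suc (Suc K)) 0)) \<le> (2 * B + 2 * C) / 3 ^ K"
    using n(2) nK by (intro norm_average_diff) auto
  also have "\<dots> < e / 3" using N1 K(3) by simp
  finally have e1: "norm (sum (a 0) {u..<u + n} /\<^sub>R real_of_int n - ((1 - \<theta>) *\<^sub>R a (Suc K) 0 + \<theta> *\<^sub>R a (Suc (Suc K)) 0)) < e / 3" .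
  have e2: "norm (((1 - \<theta>) *\<^sub>R a (Suc K) 0 + \<theta> *\<^sub>R a (Suc (Suc K)) 0)
     - ((1 - \<theta>) *\<^sub>R x (Suc K) + \<theta> *\<^sub>R x (Suc (Suc K)))) \<le> e / 3"
    using K'(2) near by (intro norm_mix_diff) auto
  have "norm (sum (a 0) {u..<u + n} /\<^sub>R real_of_int n - \<rho>) < e"
    by (rule norm_diff_chain[OF e1 e2]) (use K' K(1) in \<open>simp add: norm_minus_commute\<close>)
  then have "norm (sum (a 0) {u..<u + int (nat n)} /\<^sub>R real (nat n) - \<rho>) < e"
    using nK by simp
  moreover have "nat n \<ge> N" "nat n > 0" using nK K(2) by auto
  ultimately show "\<exists>n\<ge>N. \<exists>u. n > 0 \<and> norm (sum (a 0) {u..<u + int n} /\<^sub>R real n - \<rho>) < e"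
    by blast
qed

end

text \<open>
  Both coordinates are built on the same blocks, so that the vectors of block averages form
  one hierarchy. The central totals are the prescribed averages rounded to integral totals,
  which is harmless in the limit.
\<close>
lemma recurrent_sequence_with_prescribed_windows:
  fixes x :: "nat \<Rightarrow> real^2"
  assumes x: "\<And>K i. x K $ i \<in> {2..3}"
  shows "\<exists>s :: int \<Rightarrow> real^2. (\<forall>t i. s t $ i \<in> \<int> \<and> s t $ i \<in> {1..4}) \<and> uniformly_recurrent s \<and>
    (\<forall>\<rho>\<in>window_limits s. \<forall>e>0. \<exists>i j. \<exists>\<theta>\<in>{0..1}. norm (\<rho> - ((1 - \<theta>) *\<^sub>R x i + \<theta> *\<^sub>R x j)) < e) \<and>
    (\<forall>\<rho>. (\<forall>e>0. \<forall>N. \<exists>K\<ge>N. \<exists>\<theta>\<in>{0..1}. norm (\<rho> - ((1 - \<theta>) *\<^sub>R x K + \<theta> *\<^sub>R x (Suc K))) < e)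
      \<longrightarrow> \<rho> \<in> window_limits s)"
proof -
  define \<sigma> where "\<sigma> i K = \<lfloor>block_len K * x K $ i\<rfloor>" for i K
  define a :: "nat \<Rightarrow> int \<Rightarrow> real^2" where "a K j = (\<chi> i. block_total (\<sigma> i) K j / block_len K)" for K j
  have l: "real_of_int (block_len K) > 0" for K using block_len_pos by simp
  have \<sigma>: "2 * block_len K \<le> \<sigma> i K" "\<sigma> i K \<le> 3 * block_len K" for i K
  proof -
    have "2 * block_len K \<le> block_len K * x K $ i" "block_len K * x K $ i \<le> 3 * block_len K"
      using x[of K i] l[of K] by (auto simp: mult.commute)
    then show "2 * block_len K \<le> \<sigma> i K" "\<sigma> i K \<le> 3 * block_len K"
      unfolding \<sigma>_def by (auto simp: le_floor_iff floor_le_iff)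
  qed
  have comp: "block_len K \<le> block_total (\<sigma> i) K j \<and> block_total (\<sigma> i) K j \<le> 4 * block_len K" for K i j
    using block_total_bounds[of "\<sigma> i" K j, OF \<sigma>] slack_le[of K] by auto
  have close: "norm (a K (3 ^ Suc K * i + q) - a (Suc K) i) \<le> 4 / 3 ^ K"
    if "q \<noteq> 0" "2 * \<bar>q\<bar> < 3 ^ Suc K" for K i q
    using norm_le_components[of "a K (3 ^ Suc K * i + q) - a (Suc K) i"]
      block_total_close[of "\<sigma> 1" q K i, OF \<sigma> that] block_total_close[of "\<sigma> 2" q K i, OF \<sigma> that]
    by (simp add: a_def)
  interpret block_hierarchy a 8 4
  proof
    fix K and j :: int
    show "norm (a K j) \<le> 8"
    proof -
      have "\<bar>a K j $ i\<bar> \<le> 4" for i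
        using comp[of K i j] l[of K] by (simp add: a_def divide_le_eq)
      from this[of 1] this[of 2] show ?thesis using norm_le_components[of "a K j"] by linarith
    qed
    show "a K (3 ^ Suc K * j) = a K 0"
      unfolding a_def block_total_central by simp
  next
    fix K i r
    assume r: "(3::int) ^ Suc K = 2 * r + 1" "r > 0"
    have "(\<Sum>q = -r..r. block_total (\<sigma> k) K (3 ^ Suc K * i + q)) = block_total (\<sigma> k) (Suc K) i" for k
    proof -
      have "(\<Sum>q = -r..r. block_total (\<sigma> k) K (3 ^ Suc K * i + q))
          = (\<Sum>q = -r..r. child_total (2 * r + 1) (\<sigma> k K) (block_total (\<sigma> k) (Suc K) i) q)"
      proof (rule sum.cong)
        fix q assume "q \<in> {-r..r}"
        then have "2 * \<bar>q\<bar> < 3 ^ Suc K" unfolding r(1) by auto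
        from block_total_child[OF this] show "block_total (\<sigma> k) K (3 ^ Suc K * i + q) =
            child_total (2 * r + 1) (\<sigma> k K) (block_total (\<sigma> k) (Suc K) i) q" unfolding r(1) .
      qed simp
      then show ?thesis by (simp add: sum_child_total[OF r(2)])
    qed
    then have "(\<Sum>q = -r..r. real_of_int (block_total (\<sigma> k) K (3 ^ Suc K * i + q))) = block_total (\<sigma> k) (Suc K) i" for k
      by (simp flip: of_int_sum)
    then show "(\<Sum>q = -r..r. a K (3 ^ Suc K * i + q)) = 3 ^ Suc K *\<^sub>R a (Suc K) i"
      by (simp add: vec_eq_iff a_def block_len.simps flip: sum_divide_distrib)
  qed (rule close)
  have center: "norm (a K 0 - x K) \<le> 2 / 3 ^ K" for K
  proof -
    have "\<bar>(a K 0 - x K) $ i\<bar> \<le> 1 / 3 ^ K" for i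
    proof -
      have "\<bar>\<sigma> i K - block_len K * x K $ i\<bar> \<le> 1" unfolding \<sigma>_def by linarith
      then have "\<bar>\<sigma> i K - block_len K * x K $ i\<bar> / block_len K \<le> 1 / block_len K"
        using l[of K] by (intro divide_right_mono) auto
      moreover have "\<bar>\<sigma> i K - block_len K * x K $ i\<bar> / block_len K = \<bar>(a K 0 - x K) $ i\<bar>"
      proof -
        have "(a K 0 - x K) $ i = (\<sigma> i K - block_len K * x K $ i) / block_len K"
          using l[of K] by (simp add: a_def field_simps)
        then show ?thesis using l[of K] by (simp add: abs_divide)
      qed
      moreover have "1 / block_len K \<le> 1 / 3 ^ K"
      proof -
        have "real_of_int (3 ^ K) \<le> block_len K" using block_len_ge[of K] by (simp only: of_int_le_iff)
        then show ?thesis by (intro frac_le) auto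
      qed
      ultimately show ?thesis by linarith
    qed
    from this[of 1] this[of 2] show ?thesis using norm_le_components[of "a K 0 - x K"] by simp
  qed
  have ints: "\<forall>t i. a 0 t $ i \<in> \<int> \<and> a 0 t $ i \<in> {1..4}"
    using comp[of 0] by (simp add: a_def)
  have rec: "uniformly_recurrent (a 0)"
    unfolding uniformly_recurrent_def
  proof
    fix N :: int
    define K where "K = nat (2 * N)"
    have "2 * N \<le> int K" by (simp add: K_def)
    moreover have "int K < 2 ^ K" using of_nat_less_two_power[of K] by simp
    moreover have "(2::int) ^ K \<le> 3 ^ K" by (rule power_mono) auto
    ultimately have N: "2 * N < block_len K" using block_len_ge[of K] by linarith
    have "a 0 (t + i * block_len (Suc K)) = a 0 t" if "\<bar>t\<bar> \<le> N" for i t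
    proof -
      have "block_total (\<sigma> k) 0 (block_len K * (3 ^ Suc K * i) + t) = block_total (\<sigma> k) 0 (block_len K * 0 + t)" for k
        using that N by (intro block_total_recurrence) (auto simp: block_total_central simp del: power_Suc)
      then have "block_total (\<sigma> k) 0 (t + i * block_len (Suc K)) = block_total (\<sigma> k) 0 t" for k
        by (simp add: block_len.simps algebra_simps)
      then show ?thesis by (simp add: a_def)
    qed
    then show "\<exists>P>0. \<forall>i t. \<bar>t\<bar> \<le> N \<longrightarrow> a 0 (t + i * P) = a 0 t"
      using block_len_pos by blast
  qed
  show ?thesis
  proof (intro exI[of _ "a 0"] conjI ballI allI impI)
    fix \<rho> and e :: real
    assume "\<rho> \<in> window_limits (a 0)" "e > 0"
    then show "\<exists>i j. \<exists>\<theta>\<in>{0..1}. norm (\<rho> - ((1 - \<theta>) *\<^sub>R x i + \<theta> *\<^sub>R x j)) < e"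
      using window_limits_near_mixture[of x 2 \<rho> e, OF center] by fastforce
  next
    fix \<rho>
    assume "\<forall>e>0. \<forall>N. \<exists>K\<ge>N. \<exists>\<theta>\<in>{0..1}. norm (\<rho> - ((1 - \<theta>) *\<^sub>R x K + \<theta> *\<^sub>R x (Suc K))) < e"
    then show "\<rho> \<in> window_limits (a 0)"
      by (intro mixture_in_window_limits[of x 2, OF center]) auto
  qed (use ints rec in auto)
qed

section \<open>Minimal sets with prescribed rotation sets\<close>

lemma minimal_set_with_prescribed_rotation:
  fixes x :: "nat \<Rightarrow> real^2"
  assumes x: "\<And>K i. x K $ i \<in> {2..3}"
  obtains M where "minimal_set (induced_map shear_lift) M"
    "\<And>\<rho> e. \<rho> \<in> rotation_set M shear_lift \<Longrightarrow> e > 0 \<Longrightarrow>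
      \<exists>i j. \<exists>\<theta>\<in>{0..1}. norm (\<rho> - ((1 - \<theta>) *\<^sub>R x i + \<theta> *\<^sub>R x j)) < e"
    "\<And>\<rho>. (\<And>e N. e > 0 \<Longrightarrow> \<exists>K\<ge>N. \<exists>\<theta>\<in>{0..1}. norm (\<rho> - ((1 - \<theta>) *\<^sub>R x K + \<theta> *\<^sub>R x (Suc K))) < e)
      \<Longrightarrow> \<rho> \<in> rotation_set M shear_lift"
proof -
  obtain s :: "int \<Rightarrow> real^2" where s: "\<forall>t i. s t $ i \<in> \<int> \<and> s t $ i \<in> {1..4}" "uniformly_recurrent s"
    and upper: "\<forall>\<rho>\<in>window_limits s. \<forall>e>0. \<exists>i j. \<exists>\<theta>\<in>{0..1}. norm (\<rho> - ((1 - \<theta>) *\<^sub>R x i + \<theta> *\<^sub>R x j)) < e"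
    and lower: "\<forall>\<rho>. (\<forall>e>0. \<forall>N. \<exists>K\<ge>N. \<exists>\<theta>\<in>{0..1}. norm (\<rho> - ((1 - \<theta>) *\<^sub>R x K + \<theta> *\<^sub>R x (Suc K))) < e)
      \<longrightarrow> \<rho> \<in> window_limits s"
    using recurrent_sequence_with_prescribed_windows[of x, OF x] by blast
  obtain M where M: "minimal_set (induced_map shear_lift) M" "rotation_set M shear_lift = window_limits s"
    using coded_minimal_set[of s] s by blast
  show thesis
    by (rule that[of M]) (use M upper lower in \<open>simp_all only: M(2), blast+\<close>)
qed

text \<open>
  The factor \<open>1/16\<close> keeps both endpoints of the segment in the square \<open>[2, 3] \<times> [2, 3]\<close> of
  admissible averages for all \<open>v\<close> in the ball.
\<close>
lemma segment_rotation_set: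
  fixes v :: "real^2"
  assumes v: "v \<in> ball (vector [5/2, 5/2]) (1/4)"
  shows "\<exists>M. minimal_set (induced_map shear_lift) M \<and>
    (\<exists>a b. a \<noteq> b \<and> rotation_set M shear_lift = closed_segment a b) \<and>
    (\<exists>w. w \<noteq> 0 \<and> orthogonal v w \<and> rotation_set M shear_lift \<subseteq> range (\<lambda>t. v + t *\<^sub>R w))"
proof -
  have vi: "\<bar>v $ i - 5/2\<bar> < 1/4" for i
  proof -
    have "\<bar>(vector [5/2, 5/2] - v) $ i\<bar> \<le> norm (vector [5/2, 5/2] - v)"
      by (rule component_le_norm_cart)
    moreover have "(vector [5/2, 5/2] :: real^2) $ i = 5/2" using exhaust_2[of i] by auto
    ultimately show ?thesis using v by (simp add: dist_norm abs_minus_commute)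
  qed
  define w :: "real^2" where "w = vector [- v $ 2, v $ 1]"
  define p where "p = v - (1/16) *\<^sub>R w"
  define q where "q = v + (1/16) *\<^sub>R w"
  define x where "x K = (if even K then p else q)" for K :: nat
  have w0: "w \<noteq> 0"
    using vi[of 1] by (auto simp: w_def vec2_eq_iff)
  have orth: "orthogonal v w"
    by (simp add: orthogonal_def inner_vec_def sum_2 w_def)
  have "p $ i \<in> {2..3} \<and> q $ i \<in> {2..3}" for i
  proof -
    have "9/4 < v $ j \<and> v $ j < 11/4" for j using vi[of j] unfolding abs_less_iff by linarith
    from this[of 1] this[of 2] show ?thesis
      using exhaust_2[of i] by (auto simp: p_def q_def w_def)
  qed
  then have "x K $ i \<in> {2..3}" for K i by (simp add: x_def)
  then obtain M where M: "minimal_set (induced_map shear_lift) M"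
    and upper: "\<And>\<rho> e. \<rho> \<in> rotation_set M shear_lift \<Longrightarrow> e > 0 \<Longrightarrow>
      \<exists>i j. \<exists>\<theta>\<in>{0..1}. norm (\<rho> - ((1 - \<theta>) *\<^sub>R x i + \<theta> *\<^sub>R x j)) < e"
    and lower: "\<And>\<rho>. (\<And>e N. e > 0 \<Longrightarrow> \<exists>K\<ge>N. \<exists>\<theta>\<in>{0..1}. norm (\<rho> - ((1 - \<theta>) *\<^sub>R x K + \<theta> *\<^sub>R x (Suc K))) < e)
      \<Longrightarrow> \<rho> \<in> rotation_set M shear_lift"
    by (rule minimal_set_with_prescribed_rotation[of x]) auto
  have seg: "rotation_set M shear_lift = closed_segment p q"
  proof (intro equalityI subsetI)
    fix \<rho> assume \<rho>: "\<rho> \<in> rotation_set M shear_lift"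
    have "\<exists>y\<in>closed_segment p q. dist y \<rho> < e" if e: "e > 0" for e
    proof -
      obtain i j \<theta> where y: "\<theta> \<in> {0..1}" "norm (\<rho> - ((1 - \<theta>) *\<^sub>R x i + \<theta> *\<^sub>R x j)) < e"
        using upper[OF \<rho> e] by blast
      have "x i \<in> closed_segment p q" "x j \<in> closed_segment p q" by (simp_all add: x_def)
      then have "(1 - \<theta>) *\<^sub>R x i + \<theta> *\<^sub>R x j \<in> closed_segment p q"
        using y(1) by (intro convexD_alt[OF convex_closed_segment]) auto
      then show ?thesis using y(2) by (metis dist_norm dist_commute)
    qed
    then have "\<rho> \<in> closure (closed_segment p q)" unfolding closure_approachable by blast
    then show "\<rho> \<in> closed_segment p q" by simp
  next
    fix \<rho> assume "\<rho> \<in> closed_segment p q"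
    then obtain t where t: "0 \<le> t" "t \<le> 1" "\<rho> = (1 - t) *\<^sub>R p + t *\<^sub>R q" by (auto simp: in_segment)
    show "\<rho> \<in> rotation_set M shear_lift"
    proof (rule lower)
      fix e :: real and N :: nat assume "e > 0"
      then have "norm (\<rho> - ((1 - t) *\<^sub>R x (2 * N) + t *\<^sub>R x (Suc (2 * N)))) < e"
        by (simp add: x_def t(3))
      then show "\<exists>K\<ge>N. \<exists>\<theta>\<in>{0..1}. norm (\<rho> - ((1 - \<theta>) *\<^sub>R x K + \<theta> *\<^sub>R x (Suc K))) < e"
        using t(1,2) by (intro exI[of _ "2 * N"] conjI bexI[of _ t]) auto
    qed
  qed
  have "p \<noteq> q" using w0 by (simp add: p_def q_def eq_diff_eq[symmetric] flip: scaleR_left_distrib)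
  moreover have "closed_segment p q \<subseteq> range (\<lambda>t. v + t *\<^sub>R w)"
  proof
    fix \<rho> assume "\<rho> \<in> closed_segment p q"
    then obtain t where "\<rho> = (1 - t) *\<^sub>R p + t *\<^sub>R q" by (auto simp: in_segment)
    then have "\<rho> = v + (t / 8 - 1 / 16) *\<^sub>R w"
      by (simp add: p_def q_def vec2_eq_iff field_simps)
    then show "\<rho> \<in> range (\<lambda>t. v + t *\<^sub>R w)" by blast
  qed
  ultimately show ?thesis using M seg w0 orth by metis
qed

text \<open>
  Consecutive vertices realise the edges. Every mixture of two vertices lies on an edge, hence
  has distance at least \<open>1/6\<close> from the barycentre. So the rotation set contains the boundary
  of the triangle, but neither the barycentre nor points far away.
\<close>
lemma triangle_rotation_set:
  "\<exists>M. minimal_set (induced_map shear_lift) M \<and> plane_separating (rotation_set M shear_lift)"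
proof -
  define A :: "real^2" where "A = vector [2, 2]"
  define B :: "real^2" where "B = vector [3, 2]"
  define C :: "real^2" where "C = vector [2, 3]"
  define x where "x K = (if K mod 3 = 0 then A else if K mod 3 = 1 then B else C)" for K :: nat
  have comps: "A $ 1 = 2" "A $ 2 = 2" "B $ 1 = 3" "B $ 2 = 2" "C $ 1 = 2" "C $ 2 = 3"
    by (simp_all add: A_def B_def C_def)
  have x_cases: "x K = A \<or> x K = B \<or> x K = C" for K by (simp add: x_def)
  have "x K $ i \<in> {2..3}" for K i
    using x_cases[of K] exhaust_2[of i] comps by auto
  then obtain M where M: "minimal_set (induced_map shear_lift) M"
    and upper: "\<And>\<rho> e. \<rho> \<in> rotation_set M shear_lift \<Longrightarrow> e > 0 \<Longrightarrow>
      \<exists>i j. \<exists>\<theta>\<in>{0..1}. norm (\<rho> - ((1 - \<theta>) *\<^sub>R x i + \<theta> *\<^sub>R x j)) < e"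
    and lower: "\<And>\<rho>. (\<And>e N. e > 0 \<Longrightarrow> \<exists>K\<ge>N. \<exists>\<theta>\<in>{0..1}. norm (\<rho> - ((1 - \<theta>) *\<^sub>R x K + \<theta> *\<^sub>R x (Suc K))) < e)
      \<Longrightarrow> \<rho> \<in> rotation_set M shear_lift"
    by (rule minimal_set_with_prescribed_rotation[of x]) auto
  define R where "R = rotation_set M shear_lift"
  define inside :: "(real^2) set" where "inside = {z. 2 < z $ 1 \<and> 2 < z $ 2 \<and> z $ 1 + z $ 2 < 5}"
  define outside :: "(real^2) set" where "outside = {z. z $ 1 < 2 \<or> z $ 2 < 2 \<or> 5 < z $ 1 + z $ 2}"
  have edge: "z \<in> R" if "z = (1 - t) *\<^sub>R x k + t *\<^sub>R x (Suc k)" "t \<in> {0..1}" for z t k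
    unfolding R_def
  proof (rule lower)
    fix e :: real and N :: nat assume e: "e > 0"
    have "x (k + 3 * N) = x k" "x (Suc (k + 3 * N)) = x (Suc k)"
      unfolding x_def by (simp_all only: mod_mult_self2 flip: add_Suc)
    then have "norm (z - ((1 - t) *\<^sub>R x (k + 3 * N) + t *\<^sub>R x (Suc (k + 3 * N)))) < e"
      using that(1) e by simp
    then show "\<exists>K\<ge>N. \<exists>\<theta>\<in>{0..1}. norm (z - ((1 - \<theta>) *\<^sub>R x K + \<theta> *\<^sub>R x (Suc K))) < e"
      using that(2) by (intro exI[of _ "k + 3 * N"] conjI bexI[of _ t]) auto
  qed
  have x012: "x 0 = A" "x (Suc 0) = B" "x (Suc (Suc 0)) = C" "x (Suc (Suc (Suc 0))) = A"
    by (simp_all add: x_def)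
  have boundary: "z \<in> R" if z: "z \<notin> inside" "z \<notin> outside" for z
  proof -
    have le: "2 \<le> z $ 1" "2 \<le> z $ 2" "z $ 1 + z $ 2 \<le> 5" using z(2) by (auto simp: outside_def)
    consider "z $ 2 = 2" | "z $ 1 + z $ 2 = 5" | "z $ 1 = 2"
      using z(1) le by (auto simp: inside_def)
    then show ?thesis
    proof cases
      case 1
      show ?thesis
        by (rule edge[of _ "z $ 1 - 2" 0]) (use 1 le in \<open>simp_all add: x012 vec2_eq_iff comps algebra_simps\<close>)
    next
      case 2
      show ?thesis
        by (rule edge[of _ "z $ 2 - 2" "Suc 0"]) (use 2 le in \<open>simp_all add: x012 vec2_eq_iff comps algebra_simps\<close>)
    next
      case 3
      show ?thesis
        by (rule edge[of _ "3 - z $ 2" "Suc (Suc 0)"]) (use 3 le in \<open>simp_all add: x012 vec2_eq_iff comps algebra_simps\<close>)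
    qed
  qed
  have mixture: "2 \<le> y $ 1 \<and> (y $ 1 = 2 \<or> y $ 2 = 2 \<or> y $ 1 + y $ 2 = 5)"
    if "y = (1 - \<theta>) *\<^sub>R x i + \<theta> *\<^sub>R x j" "\<theta> \<in> {0..1}" for y \<theta> i j
  proof -
    have "y $ 1 = (1 - \<theta>) * x i $ 1 + \<theta> * x j $ 1" "y $ 2 = (1 - \<theta>) * x i $ 2 + \<theta> * x j $ 2"
      by (simp_all add: that(1))
    moreover have "0 \<le> \<theta>" "\<theta> \<le> 1" using that(2) by auto
    ultimately show ?thesis
      using x_cases[of i] x_cases[of j] by (elim disjE) (simp_all add: comps algebra_simps)
  qed
  have centre: "vector [7/3, 7/3] \<notin> R"
  proof
    define g :: "real^2" where "g = vector [7/3, 7/3]"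
    assume "vector [7/3, 7/3] \<in> R"
    then obtain i j \<theta> where y: "\<theta> \<in> {0..1}" "norm (g - ((1 - \<theta>) *\<^sub>R x i + \<theta> *\<^sub>R x j)) < 1/6"
      using upper[of g "1/6"] by (auto simp: R_def g_def)
    define y where "y = (1 - \<theta>) *\<^sub>R x i + \<theta> *\<^sub>R x j"
    have "\<bar>7/3 - y $ 1\<bar> < 1/6" "\<bar>7/3 - y $ 2\<bar> < 1/6"
      using y(2) component_le_norm_cart[of "g - y" 1] component_le_norm_cart[of "g - y" 2]
      by (auto simp: g_def y_def)
    then have "13/6 < y $ 1" "y $ 1 < 5/2" "13/6 < y $ 2" "y $ 2 < 5/2"
      unfolding abs_less_iff by linarith+
    then show False using mixture[OF y_def y(1)] by linarith
  qed
  have origin: "0 \<notin> R"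
  proof
    assume "0 \<in> R"
    then obtain i j \<theta> where y: "\<theta> \<in> {0..1}" "norm (0 - ((1 - \<theta>) *\<^sub>R x i + \<theta> *\<^sub>R x j)) < 1"
      using upper[of 0 1] by (auto simp: R_def)
    define y where "y = (1 - \<theta>) *\<^sub>R x i + \<theta> *\<^sub>R x j"
    have "\<bar>y $ 1\<bar> < 1"
      using y(2) component_le_norm_cart[of "0 - y" 1] by (simp add: y_def)
    then show False using mixture[OF y_def y(1)] by auto
  qed
  have "open inside" "open outside"
    unfolding inside_def outside_def
    by (intro open_Collect_conj open_Collect_disj open_Collect_less continuous_intros)+
  moreover have "UNIV - R \<subseteq> inside \<union> outside" using boundary by blast
  moreover have "inside \<inter> outside \<inter> (UNIV - R) = {}" by (auto simp: inside_def outside_def)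
  moreover have "inside \<inter> (UNIV - R) \<noteq> {}"
  proof -
    have "vector [7/3, 7/3] \<in> inside" by (simp add: inside_def)
    with centre show ?thesis by blast
  qed
  moreover have "outside \<inter> (UNIV - R) \<noteq> {}"
  proof -
    have "0 \<in> outside" by (simp add: outside_def)
    with origin show ?thesis by blast
  qed
  ultimately have "\<not> connected (UNIV - R)"
    using connectedD[of "UNIV - R" inside outside] by blast
  then show ?thesis using M unfolding plane_separating_def R_def by blast
qed

text \<open>
  If every non-empty open subset of the disc contains \<open>x\<^sub>K\<close> for infinitely many \<open>K\<close>, then each
  point of the disc is a limit of the vectors \<open>x\<^sub>K\<close>, which are mixtures with \<open>\<theta> = 0\<close>.
\<close>
lemma fat_rotation_set:
  "\<exists>M. minimal_set (induced_map shear_lift) M \<and> interior (rotation_set M shear_lift) \<noteq> {}"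
proof -
  define c :: "real^2" where "c = vector [5/2, 5/2]"
  obtain D :: "(real^2) set" where D: "countable D" "\<And>X. open X \<Longrightarrow> X \<noteq> {} \<Longrightarrow> \<exists>d\<in>D. d \<in> X"
    using countable_dense_exists by blast
  define d where "d = from_nat_into D"
  have "D \<noteq> {}" using D(2)[of UNIV] by auto
  then have range_d: "range d = D" using D(1) by (simp add: d_def)
  define x where "x K = (if d K \<in> ball c (1/2) then d K else c)" for K
  have "z $ i \<in> {2..3}" if "z \<in> ball c (1/2)" for z i
  proof -
    have "\<bar>(c - z) $ i\<bar> \<le> norm (c - z)" by (rule component_le_norm_cart)
    moreover have "c $ i = 5/2" using exhaust_2[of i] by (auto simp: c_def)
    ultimately show ?thesis using that by (auto simp: dist_norm abs_if split: if_splits)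
  qed
  then have "x K $ i \<in> {2..3}" for K i by (simp add: x_def)
  then obtain M where M: "minimal_set (induced_map shear_lift) M"
    and lower: "\<And>\<rho>. (\<And>e N. e > 0 \<Longrightarrow> \<exists>K\<ge>N. \<exists>\<theta>\<in>{0..1}. norm (\<rho> - ((1 - \<theta>) *\<^sub>R x K + \<theta> *\<^sub>R x (Suc K))) < e)
      \<Longrightarrow> \<rho> \<in> rotation_set M shear_lift"
    by (rule minimal_set_with_prescribed_rotation[of x]) auto
  have "ball c (1/2) \<subseteq> rotation_set M shear_lift"
  proof (intro subsetI lower)
    fix \<rho> and e :: real and N :: nat
    assume \<rho>: "\<rho> \<in> ball c (1/2)" and e: "e > 0"
    define U where "U = ball \<rho> e \<inter> ball c (1/2)"
    have U: "open U" "\<rho> \<in> U" using \<rho> e by (auto simp: U_def)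
    have "U - d ` {..<N} \<noteq> {}"
    proof
      assume "U - d ` {..<N} = {}"
      then have "finite U" by (metis Diff_eq_empty_iff finite_imageI finite_lessThan finite_subset)
      then show False using finite_imp_not_open[of U] U by auto
    qed
    moreover have "open (U - d ` {..<N})"
      using U(1) by (intro open_Diff finite_imp_closed) auto
    ultimately obtain K where K: "d K \<in> U - d ` {..<N}" using D(2) range_d by (metis imageE)
    then have "K \<ge> N" by (meson DiffD2 imageI lessThan_iff not_le)
    moreover have "norm (\<rho> - ((1 - 0) *\<^sub>R x K + 0 *\<^sub>R x (Suc K))) < e"
      using K by (simp add: U_def x_def dist_norm)
    ultimately show "\<exists>K\<ge>N. \<exists>\<theta>\<in>{0..1}. norm (\<rho> - ((1 - \<theta>) *\<^sub>R x K + \<theta> *\<^sub>R x (Suc K))) < e"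
      by (intro exI[of _ K] conjI bexI[of _ 0]) auto
  qed
  then have "ball c (1/2) \<subseteq> interior (rotation_set M shear_lift)"
    by (rule interior_maximal) simp
  then have "interior (rotation_set M shear_lift) \<noteq> {}" by (auto simp: subset_empty)
  then show ?thesis using M by blast
qed

theorem theorem1p1:
  "\<exists>(f :: torus \<Rightarrow> torus) (F :: real^2 \<Rightarrow> real^2).
     (\<exists>g. homeomorphism UNIV UNIV f g) \<and>
     homotopic_with_canon (\<lambda>_. True) UNIV UNIV f id \<and>
     is_lift f F \<and>
     (\<exists>V :: (real^2) set. open V \<and> V \<noteq> {} \<and> V \<subseteq> UNIV - {0} \<and>
        (\<forall>v\<in>V. \<exists>M. minimal_set f M \<and>
           (\<exists>a b. a \<noteq> b \<and> rotation_set M F = closed_segment a b) \<and>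
           (\<exists>w. w \<noteq> 0 \<and> orthogonal v w \<and>
              rotation_set M F \<subseteq> range (\<lambda>t. v + t *\<^sub>R w)))) \<and>
     (\<exists>M. minimal_set f M \<and> plane_separating (rotation_set M F)) \<and>
     (\<exists>M. minimal_set f M \<and> interior (rotation_set M F) \<noteq> {})"
proof (rule exI[of _ "induced_map shear_lift"], rule exI[of _ shear_lift], intro conjI)
  show "\<exists>g. homeomorphism UNIV UNIV (induced_map shear_lift) g"
    using homeomorphism_induced_map[OF equivariant_shear_lift(1) continuous_shear_lift(1)
        equivariant_shear_lift(2) continuous_shear_lift(2) shear_lift_inverse] by blast
  show "homotopic_with_canon (\<lambda>_. True) UNIV UNIV (induced_map shear_lift) id"
    by (intro homotopic_induced_map_id equivariant_shear_lift continuous_shear_lift)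
  show "is_lift (induced_map shear_lift) shear_lift"
    by (intro is_lift_induced_map equivariant_shear_lift continuous_shear_lift)
  show "\<exists>V :: (real^2) set. open V \<and> V \<noteq> {} \<and> V \<subseteq> UNIV - {0} \<and>
        (\<forall>v\<in>V. \<exists>M. minimal_set (induced_map shear_lift) M \<and>
           (\<exists>a b. a \<noteq> b \<and> rotation_set M shear_lift = closed_segment a b) \<and>
           (\<exists>w. w \<noteq> 0 \<and> orthogonal v w \<and>
              rotation_set M shear_lift \<subseteq> range (\<lambda>t. v + t *\<^sub>R w)))"
  proof (intro exI[of _ "ball (vector [5/2, 5/2]) (1/4)"] conjI ballI)
    have "(0 :: real^2) \<notin> ball (vector [5/2, 5/2]) (1/4)"
      using component_le_norm_cart[of "vector [5/2, 5/2] :: real^2" 1] by (auto simp: dist_norm)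
    then show "ball (vector [5/2, 5/2] :: real^2) (1/4) \<subseteq> UNIV - {0}" by blast
  qed (use segment_rotation_set in auto)
qed (fact triangle_rotation_set fat_rotation_set)+

end
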